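(* Let $k$ be a field of characteristic zero and $m\geq 3$ an integer. Let $\mathcal{S}$ be the $m\times m$ generic symmetric matrix over $k$, let $\mathcal{DS}$ denote any $(m+2)$-ladderlike degeneration of $\mathcal{S}$, and let $f=\det(\mathcal{DS})$. Then $\dim V(f)^*\geq m-1$, where $V(f)^*$ is the dual variety of the hypersurface $V(f)$.
   Context: The generic symmetric matrix $\mathcal{S}$ has $(i,j)$-entry $x_{\min(i,j),\max(i,j)}$, where $x_{i,j}$ ($1\leq i\leq j\leq m$) are indeterminates over $k$; let $S=k[x_{i,j}\mid 1\leq i\leq j\leq m]$. A coordinate-like degeneration of $\mathcal{S}$ is the matrix $\mathcal{DS}$ obtained by applying to the entries of $\mathcal{S}$ a $k$-algebra endomorphism of $S$ induced by a $k$-linear map of $S_1$ that maps each variable to a variable or to $0$. It is $(m+2)$-ladderlike if the defining endomorphism fixes every variable $x_{i,j}$ ($i\leq j$) such that $i+j\leq m+2$. The determinant $f$ is regarded as a form in the polynomial ring $R$ over $k$ generated by the (nonzero) entries of $\mathcal{DS}$, and $V(f)$ is the hypersurface of $\mathrm{Proj}(R)$ it defines; the dual variety $V(f)^*$ is the closure, in the dual projective space, of the set of hyperplanes tangent to $V(f)$ at smooth points. Dimension is the dimension as a projective variety. *)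

theory Defs
  imports
    "HOL-Library.Poly_Mapping"
    "HOL-Library.Extended_Nat"
    "HOL-Algebra.Algebraic_Closure_Type"
    "HOL-Analysis.Abstract_Topology"
    "Jordan_Normal_Form.Determinant"
begin

section \<open>Multivariate polynomials\<close>

text \<open>A polynomial is a finitely supported map from monomials to coefficients, and a monomial
  is a finitely supported map from variables to exponents.\<close>

type_synonym ('v, 'a) mpoly = "('v \<Rightarrow>\<^sub>0 nat) \<Rightarrow>\<^sub>0 'a"

definition Const :: "'a::zero \<Rightarrow> ('v, 'a) mpoly" where
  "Const c = Poly_Mapping.single 0 c"

definition Var :: "'v \<Rightarrow> ('v, 'a::zero_neq_one) mpoly" where
  "Var v = Poly_Mapping.single (Poly_Mapping.single v 1) 1"

text \<open>The polynomial ring on the set of variables \<open>E\<close>.\<close>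

definition polys_in :: "'v set \<Rightarrow> ('v, 'a::zero) mpoly set" where
  "polys_in E = {p. \<forall>u \<in> Poly_Mapping.keys p. Poly_Mapping.keys u \<subseteq> E}"

definition homogeneous :: "nat \<Rightarrow> ('v, 'a::zero) mpoly \<Rightarrow> bool" where
  "homogeneous d p \<longleftrightarrow>
     (\<forall>u \<in> Poly_Mapping.keys p. (\<Sum>v \<in> Poly_Mapping.keys u. Poly_Mapping.lookup u v) = d)"

text \<open>\<open>eval_mpoly h x\<close> applies the coefficient map \<open>h\<close> and substitutes \<open>x v\<close> for the variable
  \<open>v\<close>.  For \<open>h = Const\<close> it is the algebra endomorphism determined by the images \<open>x\<close> of the
  variables; for \<open>h = to_ac\<close> it is evaluation at a point with coordinates in the algebraic
  closure.\<close>

definition eval_mpoly :: "('a::zero \<Rightarrow> 'b::comm_semiring_1) \<Rightarrow> ('v \<Rightarrow> 'b) \<Rightarrow> ('v, 'a) mpoly \<Rightarrow> 'b" where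
  "eval_mpoly h x p =
     (\<Sum>u \<in> Poly_Mapping.keys p. h (Poly_Mapping.lookup p u) *
        (\<Prod>v \<in> Poly_Mapping.keys u. x v ^ Poly_Mapping.lookup u v))"

definition partial_deriv :: "'v \<Rightarrow> ('v, 'a::comm_semiring_1) mpoly \<Rightarrow> ('v, 'a) mpoly" where
  "partial_deriv v p =
     (\<Sum>u \<in> Poly_Mapping.keys p. Poly_Mapping.single (u - Poly_Mapping.single v 1)
        (of_nat (Poly_Mapping.lookup u v) * Poly_Mapping.lookup p u))"

section \<open>Degenerations of the generic symmetric matrix\<close>

definition sym_vars :: "nat \<Rightarrow> (nat \<times> nat) set" where
  "sym_vars m = {(i, j). 1 \<le> i \<and> i \<le> j \<and> j \<le> m}"

text \<open>Library matrices are indexed from 0, the variables from 1.\<close>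

definition generic_sym_mat :: "nat \<Rightarrow> (nat \<times> nat, 'k::field) mpoly mat" where
  "generic_sym_mat m =
     mat m m (\<lambda>(i, j). Var (min (Suc i) (Suc j), max (Suc i) (Suc j)))"

text \<open>The linear map on forms of degree 1 is given by the images \<open>\<sigma>\<close> of the variables.\<close>

definition coordinate_like :: "nat \<Rightarrow> (nat \<times> nat \<Rightarrow> (nat \<times> nat, 'k::field) mpoly) \<Rightarrow> bool" where
  "coordinate_like m \<sigma> \<longleftrightarrow>
     (\<forall>v \<in> sym_vars m. \<sigma> v = 0 \<or> (\<exists>w \<in> sym_vars m. \<sigma> v = Var w))"

definition ladderlike :: "nat \<Rightarrow> nat \<Rightarrow> (nat \<times> nat \<Rightarrow> (nat \<times> nat, 'k::field) mpoly) \<Rightarrow> bool" where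
  "ladderlike l m \<sigma> \<longleftrightarrow>
     (\<forall>(i, j) \<in> sym_vars m. i + j \<le> l \<longrightarrow> \<sigma> (i, j) = Var (i, j))"

definition degeneration ::
  "nat \<Rightarrow> (nat \<times> nat \<Rightarrow> (nat \<times> nat, 'k::field) mpoly) \<Rightarrow> (nat \<times> nat, 'k) mpoly mat" where
  "degeneration m \<sigma> = map_mat (eval_mpoly Const \<sigma>) (generic_sym_mat m)"

text \<open>The variables of the polynomial ring \<open>R\<close> generated by the nonzero entries.\<close>

definition entry_vars :: "(nat \<times> nat, 'k::field) mpoly mat \<Rightarrow> (nat \<times> nat) set" where
  "entry_vars A = {w. \<exists>i < dim_row A. \<exists>j < dim_col A. A $$ (i, j) = Var w}"

section \<open>Projective space and its Zariski topology over the ground field\<close>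

definition coord_space :: "'v set \<Rightarrow> ('v \<Rightarrow> 'a::zero) set" where
  "coord_space E = {a. \<forall>v. v \<notin> E \<longrightarrow> a v = 0}"

text \<open>A point is the set of all its homogeneous coordinate vectors.\<close>

definition proj_point :: "('v \<Rightarrow> 'a::field) \<Rightarrow> ('v \<Rightarrow> 'a) set" where
  "proj_point a = {\<lambda>v. c * a v | c. c \<noteq> 0}"

definition proj_space :: "'v set \<Rightarrow> ('v \<Rightarrow> 'a::field) set set" where
  "proj_space E = {proj_point a | a. a \<in> coord_space E \<and> a \<noteq> (\<lambda>_. 0)}"

definition vanishes_at :: "('v, 'k::field) mpoly \<Rightarrow> ('v \<Rightarrow> 'k alg_closure) set \<Rightarrow> bool" where
  "vanishes_at g p \<longleftrightarrow> (\<forall>a \<in> p. eval_mpoly to_ac a g = 0)"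

text \<open>Points have coordinates in the algebraic closure of the ground field \<open>k\<close>, while the basic
  open sets are given by forms with coefficients in \<open>k\<close>.  By the Nullstellensatz the lattice of
  closed sets is that of the scheme \<open>Proj k[E]\<close>, so closures and dimensions are the ones over
  \<open>k\<close>.\<close>

definition zariski :: "'v set \<Rightarrow> ('v \<Rightarrow> 'k::field alg_closure) set topology" where
  "zariski E = topology_generated_by
     {{p \<in> proj_space E. \<not> vanishes_at g p} | g :: ('v, 'k) mpoly.
        g \<in> polys_in E \<and> (\<exists>d. homogeneous d g)}"

definition irreducible_space :: "'a topology \<Rightarrow> bool" where
  "irreducible_space T \<longleftrightarrow> topspace T \<noteq> {} \<and>
     (\<forall>A B. closedin T A \<and> closedin T B \<and> topspace T = A \<union> B
        \<longrightarrow> A = topspace T \<or> B = topspace T)"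

text \<open>The dimension is the supremum of the lengths of strict chains of irreducible closed subsets;
  the empty space gets dimension 0 instead of the usual \<open>-\<infinity>\<close>.\<close>

definition krull_dim :: "'a topology \<Rightarrow> enat" where
  "krull_dim T = Sup {enat n | n. \<exists>Z :: nat \<Rightarrow> 'a set.
     (\<forall>i \<le> n. closedin T (Z i) \<and> irreducible_space (subtopology T (Z i))) \<and>
     (\<forall>i < n. Z i \<subset> Z (Suc i))}"

section \<open>The dual variety\<close>

definition hypersurface :: "'v set \<Rightarrow> ('v, 'k::field) mpoly \<Rightarrow> ('v \<Rightarrow> 'k alg_closure) set set" where
  "hypersurface E f = {p \<in> proj_space E. vanishes_at f p}"

text \<open>Smoothness is that of the scheme defined by \<open>f\<close>, via the Jacobian criterion.\<close>

definition smooth_points :: "'v set \<Rightarrow> ('v, 'k::field) mpoly \<Rightarrow> ('v \<Rightarrow> 'k alg_closure) set set" where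
  "smooth_points E f =
     {p \<in> hypersurface E f. \<exists>v \<in> E. \<not> vanishes_at (partial_deriv v f) p}"

definition hyperplane :: "'v set \<Rightarrow> ('v \<Rightarrow> 'a::field) \<Rightarrow> ('v \<Rightarrow> 'a) set set" where
  "hyperplane E b =
     {proj_point x | x. x \<in> coord_space E \<and> x \<noteq> (\<lambda>_. 0) \<and> (\<Sum>v \<in> E. b v * x v) = 0}"

definition tangent_hyperplane ::
  "'v set \<Rightarrow> ('v, 'k::field) mpoly \<Rightarrow> ('v \<Rightarrow> 'k alg_closure) set \<Rightarrow> ('v \<Rightarrow> 'k alg_closure) set set" where
  "tangent_hyperplane E f p =
     {proj_point x | x. x \<in> coord_space E \<and> x \<noteq> (\<lambda>_. 0) \<and>
        (\<forall>a \<in> p. (\<Sum>v \<in> E. eval_mpoly to_ac a (partial_deriv v f) * x v) = 0)}"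

text \<open>The dual projective space is given the dual coordinates, again indexed by \<open>E\<close>: the point
  with coordinates \<open>b\<close> stands for \<open>hyperplane E b\<close>.\<close>

definition dual_variety :: "'v set \<Rightarrow> ('v, 'k::field) mpoly \<Rightarrow> ('v \<Rightarrow> 'k alg_closure) set set" where
  "dual_variety E f = zariski E closure_of
     {q \<in> proj_space E. \<exists>p \<in> smooth_points E f. \<forall>b \<in> q. hyperplane E b = tangent_hyperplane E f p}"

definition proj_dim :: "'v set \<Rightarrow> ('v \<Rightarrow> 'k::field alg_closure) set set \<Rightarrow> enat" where
  "proj_dim E V = krull_dim (subtopology (zariski E) V)"

end

theory Submission
  imports Defs
begin

text \<open>Let \<open>f\<close> be the determinant of the degenerate matrix and \<open>n = m - 1\<close>.  At a symmetric matrix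
  of corank one with kernel vector \<open>v\<close> the adjugate is a multiple of \<open>v v\<^sup>T\<close>, so the partial
  derivative of \<open>f\<close> with respect to a variable \<open>w\<close> is proportional to the sum
  \<open>position_form A w v\<close> of the products \<open>v i * v j\<close> over the places \<open>(i, j)\<close> of \<open>w\<close>
  (\<open>gradient_det\<close>).  For the generic matrix this is the Veronese variety as the dual of the
  symmetric determinant.

  Which \<open>v\<close> occur as kernels?  The ladder contains the whole first row, whose variables can be
  used to solve for a matrix with given kernel \<open>v\<close>, normalized by \<open>v 0 = 1\<close>, and it contains
  the antidiagonal \<open>i + j = m + 2\<close> (counted from 1), which keeps the remaining block of size \<open>m - 1\<close>
  invertible.  So for generic \<open>v\<close> the vector of position forms at \<open>v\<close> is a point of the dual
  variety (\<open>gauss_image\<close>).  The vectors \<open>v\<close> form an affine space of dimension \<open>n\<close>, and it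
  remains to see that no dimension is lost in its image.

  The position form of the \<open>j\<close>-th variable of the first row is \<open>2 * v 0 * v j\<close>, or
  \<open>v 0 ^ 2\<close> for \<open>j = 0\<close>, plus products of coordinates other than the first
  (\<open>position_form_first_row\<close>); near the first unit vector these forms are thus independent
  coordinates.  The chain of irreducible closed sets consists of the closures of the images of
  the spaces \<open>flag i\<close>, where all but the first \<open>i + 1\<close> coordinates vanish.  Consecutive
  members differ by a count of transcendence degrees, made explicit: the first \<open>i + 2\<close>
  position forms of the first row depend on \<open>i\<close> parameters on \<open>flag i\<close> and so satisfy a
  nontrivial homogeneous relation (\<open>digit_form_vanishing_on_flag\<close>), but no such relation
  holds on \<open>flag (Suc i)\<close> (\<open>digit_form_nonzero_on_flag\<close>).  Irreducibility holds
  because the image of an affine space under a polynomial map is irreducible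
  (\<open>stratum_irreducible\<close>).\<close>

section \<open>Evaluation of polynomials\<close>

definition eval_monom :: "('v \<Rightarrow> 'b::comm_semiring_1) \<Rightarrow> ('v \<Rightarrow>\<^sub>0 nat) \<Rightarrow> 'b" where
  "eval_monom x u = (\<Prod>v \<in> Poly_Mapping.keys u. x v ^ Poly_Mapping.lookup u v)"

lemma eval_monom_superset:
  assumes "finite V" "Poly_Mapping.keys u \<subseteq> V"
  shows "eval_monom x u = (\<Prod>v \<in> V. x v ^ Poly_Mapping.lookup u v)"
  unfolding eval_monom_def using assms
  by (intro prod.mono_neutral_left) (auto simp: in_keys_iff)

lemma eval_monom_add: "eval_monom x (u + u') = eval_monom x u * eval_monom x u'"
proof -
  let ?V = "Poly_Mapping.keys u \<union> Poly_Mapping.keys u'"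
  have "Poly_Mapping.keys (u + u') \<subseteq> ?V" by (rule Poly_Mapping.keys_add)
  then show ?thesis
    by (simp add: eval_monom_superset[of ?V] lookup_add power_add prod.distrib)
qed

lemma eval_monom_0 [simp]: "eval_monom x 0 = 1"
  by (simp add: eval_monom_def)

lemma eval_monom_single [simp]: "eval_monom x (Poly_Mapping.single v n) = x v ^ n"
  by (simp add: eval_monom_def)

lemma eval_monom_sum: "eval_monom x (sum u A) = (\<Prod>a\<in>A. eval_monom x (u a))"
  by (induction A rule: infinite_finite_induct) (auto simp: eval_monom_add)

lemma eval_mpoly_alt:
  "eval_mpoly h x p = (\<Sum>u \<in> Poly_Mapping.keys p. h (Poly_Mapping.lookup p u) * eval_monom x u)"
  by (simp add: eval_mpoly_def eval_monom_def)

lemma eval_mpoly_single: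
  assumes "h 0 = 0"
  shows "eval_mpoly h x (Poly_Mapping.single u c) = h c * eval_monom x u"
  using assms by (simp add: eval_mpoly_alt)

lemma eval_mpoly_Var [simp]:
  assumes "h 0 = 0" "h 1 = 1"
  shows "eval_mpoly h x (Var v) = x v"
  using assms by (simp add: Var_def eval_mpoly_single)

lemma eval_mpoly_0 [simp]: "eval_mpoly h x 0 = 0"
  by (simp add: eval_mpoly_def)

lemma Var_neq_0 [simp]: "Var v \<noteq> (0 :: ('v, 'a::zero_neq_one) mpoly)"
  unfolding Var_def by (metis lookup_single_eq lookup_zero zero_neq_one)

lemma Var_inj [simp]: "Var v = (Var w :: ('v, 'a::zero_neq_one) mpoly) \<longleftrightarrow> v = w"
proof
  assume "Var v = (Var w :: ('v, 'a) mpoly)"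
  then have "Poly_Mapping.keys (Var v :: ('v, 'a) mpoly) = Poly_Mapping.keys (Var w :: ('v, 'a) mpoly)" by simp
  then have "Poly_Mapping.single v (1::nat) = Poly_Mapping.single w 1"
    by (simp add: Var_def)
  then have "Poly_Mapping.keys (Poly_Mapping.single v (1::nat)) = Poly_Mapping.keys (Poly_Mapping.single w (1::nat))" by simp
  then show "v = w" by simp
qed simp

lemma sum_monomials:
  "(\<Sum>u\<in>Poly_Mapping.keys p. Poly_Mapping.single u (Poly_Mapping.lookup p u)) = p"
  by (rule poly_mapping_eqI)
     (auto simp: lookup_sum lookup_single when_def in_keys_iff)

context
  fixes h :: "'a::comm_ring_1 \<Rightarrow> 'b::comm_ring_1"
  assumes hom: "comm_ring_hom h"
begin

interpretation comm_ring_hom h by (rule hom)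

lemma eval_mpoly_superset:
  assumes "finite U" "Poly_Mapping.keys p \<subseteq> U"
  shows "eval_mpoly h x p = (\<Sum>u \<in> U. h (Poly_Mapping.lookup p u) * eval_monom x u)"
  unfolding eval_mpoly_alt using assms
  by (intro sum.mono_neutral_left) (auto simp: in_keys_iff)

lemma eval_mpoly_add: "eval_mpoly h x (p + q) = eval_mpoly h x p + eval_mpoly h x q"
proof -
  let ?U = "Poly_Mapping.keys p \<union> Poly_Mapping.keys q"
  have "Poly_Mapping.keys (p + q) \<subseteq> ?U" by (rule Poly_Mapping.keys_add)
  then show ?thesis
    by (simp add: eval_mpoly_superset[of ?U] lookup_add hom_add distrib_right sum.distrib)
qed

lemma eval_mpoly_sum: "eval_mpoly h x (sum p A) = (\<Sum>a\<in>A. eval_mpoly h x (p a))"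
  by (induction A rule: infinite_finite_induct) (auto simp: eval_mpoly_add)

lemma eval_mpoly_mult: "eval_mpoly h x (p * q) = eval_mpoly h x p * eval_mpoly h x q"
proof -
  have "p * q = (\<Sum>u\<in>Poly_Mapping.keys p. \<Sum>w\<in>Poly_Mapping.keys q.
      Poly_Mapping.single (u + w) (Poly_Mapping.lookup p u * Poly_Mapping.lookup q w))"
  proof -
    have "p * q = (\<Sum>u\<in>Poly_Mapping.keys p. Poly_Mapping.single u (Poly_Mapping.lookup p u)) *
        (\<Sum>w\<in>Poly_Mapping.keys q. Poly_Mapping.single w (Poly_Mapping.lookup q w))"
      by (simp add: sum_monomials)
    then show ?thesis by (simp add: sum_product mult_single)
  qed
  then show ?thesis
    by (simp add: eval_mpoly_sum eval_mpoly_single eval_monom_add hom_mult)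
       (simp add: eval_mpoly_alt sum_product mult_ac)
qed

lemma comm_ring_hom_eval_mpoly: "comm_ring_hom (eval_mpoly h x)"
proof
  show "eval_mpoly h x 1 = 1"
    using eval_mpoly_single[of h x 0 1] by simp
qed (auto simp: eval_mpoly_add eval_mpoly_mult)

end

lemma poly_eval_mpoly:
  fixes y :: "'v \<Rightarrow> 'b::comm_ring_1 poly"
  shows "poly (eval_mpoly (\<lambda>c. [:h c:]) y p) t = eval_mpoly h (\<lambda>v. poly (y v) t) p"
  by (simp add: eval_mpoly_alt poly_sum eval_monom_def poly_prod)

text \<open>The values of the partial derivatives are the linear coefficients along the coordinate
  lines, which is how they are computed for a determinant.\<close>

lemma eval_partial_deriv:
  fixes h :: "'a::comm_ring_1 \<Rightarrow> 'b::idom" and p :: "('v, 'a) mpoly"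
  assumes hom: "comm_ring_hom h"
  shows "eval_mpoly h a (partial_deriv w p) =
    poly (pderiv (eval_mpoly (\<lambda>c. [:h c:]) (\<lambda>v. [:a v, if v = w then 1 else 0:]) p)) 0"
proof -
  interpret comm_ring_hom h by (rule hom)
  have pderiv_sum: "pderiv (sum f A) = (\<Sum>u\<in>A. pderiv (f u))" for f :: "('v \<Rightarrow>\<^sub>0 nat) \<Rightarrow> 'b poly" and A
    by (induction A rule: infinite_finite_induct) (auto simp: pderiv_add)
  let ?y = "\<lambda>v. [:a v, if v = w then 1 else 0:]"
  have mon: "poly (pderiv (eval_monom ?y u)) 0 =
      of_nat (Poly_Mapping.lookup u w) * eval_monom a (u - Poly_Mapping.single w 1)" for u :: "'v \<Rightarrow>\<^sub>0 nat"
  proof -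
    define R where "R = Poly_Mapping.keys u - {w}"
    have fR: "finite R" "w \<notin> R" by (auto simp: R_def)
    have 1: "eval_monom ?y u = ?y w ^ Poly_Mapping.lookup u w * [:\<Prod>v\<in>R. a v ^ Poly_Mapping.lookup u v:]"
    proof -
      have "eval_monom ?y u = (\<Prod>v\<in>insert w R. ?y v ^ Poly_Mapping.lookup u v)"
        by (rule eval_monom_superset) (auto simp: R_def)
      also have "\<dots> = ?y w ^ Poly_Mapping.lookup u w * (\<Prod>v\<in>R. [:a v ^ Poly_Mapping.lookup u v:])"
      proof -
        have "(\<Prod>v\<in>R. ?y v ^ Poly_Mapping.lookup u v) = (\<Prod>v\<in>R. [:a v ^ Poly_Mapping.lookup u v:])"
          using fR by (intro prod.cong) (auto simp: poly_const_pow)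
        then show ?thesis using fR by simp
      qed
      also have "(\<Prod>v\<in>R. [:a v ^ Poly_Mapping.lookup u v:]) = [:\<Prod>v\<in>R. a v ^ Poly_Mapping.lookup u v:]"
        using fR(1) by (induction R) (auto simp: one_pCons)
      finally show ?thesis .
    qed
    have 2: "eval_monom a (u - Poly_Mapping.single w 1) =
       a w ^ (Poly_Mapping.lookup u w - 1) * (\<Prod>v\<in>R. a v ^ Poly_Mapping.lookup u v)"
    proof -
      have "eval_monom a (u - Poly_Mapping.single w 1) =
        (\<Prod>v\<in>insert w R. a v ^ Poly_Mapping.lookup (u - Poly_Mapping.single w 1) v)"
        by (rule eval_monom_superset) (auto simp: R_def in_keys_iff lookup_minus lookup_single split: if_splits)
      also have "\<dots> = a w ^ (Poly_Mapping.lookup u w - 1) * (\<Prod>v\<in>R. a v ^ Poly_Mapping.lookup u v)"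
      proof -
        have "(\<Prod>v\<in>R. a v ^ Poly_Mapping.lookup (u - Poly_Mapping.single w 1) v) = (\<Prod>v\<in>R. a v ^ Poly_Mapping.lookup u v)"
          using fR by (intro prod.cong) (auto simp: lookup_minus lookup_single when_def)
        then show ?thesis using fR by (simp add: lookup_minus)
      qed
      finally show ?thesis .
    qed
    have 3: "poly (pderiv ([:a w, 1:] ^ n)) 0 = of_nat n * a w ^ (n - 1)" for n
      by (simp add: pderiv_power pderiv_pCons)
    show ?thesis unfolding 1 2
      by (subst mult.commute) (simp add: pderiv_smult 3 mult_ac del: pCons_one)
  qed
  have "eval_mpoly h a (partial_deriv w p) = (\<Sum>u\<in>Poly_Mapping.keys p.
      h (Poly_Mapping.lookup p u) * (of_nat (Poly_Mapping.lookup u w) * eval_monom a (u - Poly_Mapping.single w 1)))"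
    unfolding partial_deriv_def
    by (simp add: eval_mpoly_sum[OF hom] eval_mpoly_single hom_mult hom_of_nat mult_ac)
  also have "\<dots> = poly (pderiv (eval_mpoly (\<lambda>c. [:h c:]) ?y p)) 0"
    unfolding mon[symmetric] eval_mpoly_alt pderiv_sum
    by (simp add: poly_sum pderiv_smult)
  finally show ?thesis .
qed

lemma eval_mpoly_homogeneous_scale:
  fixes g :: "('v, 'a::comm_ring_1) mpoly" and x :: "'v \<Rightarrow> 'b::comm_ring_1"
  assumes "homogeneous d g"
  shows "eval_mpoly h (\<lambda>v. c * x v) g = c ^ d * eval_mpoly h x g"
proof -
  have "eval_monom (\<lambda>v. c * x v) u = c ^ d * eval_monom x u" if "u \<in> Poly_Mapping.keys g" for u
    using assms that
    by (simp add: eval_monom_def homogeneous_def power_mult_distrib prod.distrib flip: power_sum)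
  then show ?thesis
    by (simp add: eval_mpoly_alt sum_distrib_left mult_ac cong: sum.cong)
qed

section \<open>Functions that are polynomial on lines\<close>

text \<open>A notion of polynomial function in infinitely many coordinates that needs no polynomial ring:
  it is closed under the ring operations and determinants, and a product of two such functions is
  zero only if a factor is, by restriction to a line.  This is all that irreducibility needs.\<close>

definition polynomial_on_lines :: "((nat \<Rightarrow> 'a::comm_ring_1) \<Rightarrow> 'a) \<Rightarrow> bool" where
  "polynomial_on_lines F \<longleftrightarrow> (\<forall>v w. \<exists>p. \<forall>t. F (\<lambda>i. v i + t * w i) = poly p t)"

lemma polynomial_on_lines_const [intro]: "polynomial_on_lines (\<lambda>v. c)"
  unfolding polynomial_on_lines_def by (intro allI exI[of _ "[:c:]"]) simp

lemma polynomial_on_lines_coord [intro]: "polynomial_on_lines (\<lambda>v. v j)"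
  unfolding polynomial_on_lines_def
proof (intro allI)
  fix v w :: "nat \<Rightarrow> 'a"
  show "\<exists>p. \<forall>t. v j + t * w j = poly p t"
    by (intro exI[of _ "[:v j, w j:]"]) simp
qed

lemma polynomial_on_lines_add [intro]:
  assumes "polynomial_on_lines F" "polynomial_on_lines G"
  shows "polynomial_on_lines (\<lambda>v. F v + G v)"
  using assms unfolding polynomial_on_lines_def by (metis poly_add)

lemma polynomial_on_lines_mult [intro]:
  assumes "polynomial_on_lines F" "polynomial_on_lines G"
  shows "polynomial_on_lines (\<lambda>v. F v * G v)"
  using assms unfolding polynomial_on_lines_def by (metis poly_mult)

lemma polynomial_on_lines_uminus [intro]:
  assumes "polynomial_on_lines F"
  shows "polynomial_on_lines (\<lambda>v. - F v)"
  using assms unfolding polynomial_on_lines_def by (metis poly_minus)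

lemma polynomial_on_lines_sum [intro]:
  assumes "\<And>a. a \<in> A \<Longrightarrow> polynomial_on_lines (F a)"
  shows "polynomial_on_lines (\<lambda>v. \<Sum>a\<in>A. F a v)"
  using assms by (induction A rule: infinite_finite_induct) auto

lemma polynomial_on_lines_prod [intro]:
  assumes "\<And>a. a \<in> A \<Longrightarrow> polynomial_on_lines (F a)"
  shows "polynomial_on_lines (\<lambda>v. \<Prod>a\<in>A. F a v)"
  using assms by (induction A rule: infinite_finite_induct) auto

lemma polynomial_on_lines_power [intro]:
  assumes "polynomial_on_lines F"
  shows "polynomial_on_lines (\<lambda>v. F v ^ n)"
  using assms by (induction n) auto

lemma polynomial_on_lines_det:
  assumes "\<And>v. M v \<in> carrier_mat n n"
    and "\<And>i j. i < n \<Longrightarrow> j < n \<Longrightarrow> polynomial_on_lines (\<lambda>v. M v $$ (i, j))"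
  shows "polynomial_on_lines (\<lambda>v. det (M v))"
  unfolding det_def'[OF assms(1)]
  by (intro polynomial_on_lines_sum polynomial_on_lines_mult polynomial_on_lines_prod
      polynomial_on_lines_const assms(2))
     (auto simp: permutes_in_image)

lemma polynomial_on_lines_adj_mat:
  assumes M: "\<And>v. M v \<in> carrier_mat n n"
    and pol: "\<And>i j. i < n \<Longrightarrow> j < n \<Longrightarrow> polynomial_on_lines (\<lambda>v. M v $$ (i, j))"
    and ij: "i < n" "j < n"
  shows "polynomial_on_lines (\<lambda>v. adj_mat (M v) $$ (i, j))"
proof -
  have dim: "dim_row (M v) = n" "dim_col (M v) = n" for v using M[of v] by auto
  have "polynomial_on_lines (\<lambda>v. det (mat_delete (M v) j i))"
  proof (rule polynomial_on_lines_det[where n = "n - 1"])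
    show "mat_delete (M v) j i \<in> carrier_mat (n - 1) (n - 1)" for v
      using M by (rule mat_delete_carrier)
    show "polynomial_on_lines (\<lambda>v. mat_delete (M v) j i $$ (k, l))" if "k < n - 1" "l < n - 1" for k l
    proof -
      have "mat_delete (M v) j i $$ (k, l) =
          M v $$ (if k < j then k else Suc k, if l < i then l else Suc l)" for v
        using that by (simp add: mat_delete_def dim)
      then show ?thesis using that by (auto intro!: pol)
    qed
  qed
  then show ?thesis
    using ij by (auto simp: adj_mat_def cofactor_def dim)
qed

text \<open>On the line joining a nonzero of the one function to a nonzero of the other, both are
  nonzero polynomials, and an infinite field has a point where neither vanishes.\<close>

lemma polynomial_on_lines_nonzeros_meet:
  fixes F G :: "(nat \<Rightarrow> 'a::field_char_0) \<Rightarrow> 'a"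
  assumes "polynomial_on_lines F" "polynomial_on_lines G" "F v \<noteq> 0" "G w \<noteq> 0"
  obtains t where "F (\<lambda>i. v i + t * (w i - v i)) \<noteq> 0" "G (\<lambda>i. v i + t * (w i - v i)) \<noteq> 0"
proof -
  let ?l = "\<lambda>t i. v i + t * (w i - v i)"
  obtain p where p: "\<And>t. F (?l t) = poly p t"
    using assms(1)[unfolded polynomial_on_lines_def, rule_format, of v "\<lambda>i. w i - v i"] by auto
  obtain q where q: "\<And>t. G (?l t) = poly q t"
    using assms(2)[unfolded polynomial_on_lines_def, rule_format, of v "\<lambda>i. w i - v i"] by auto
  have "poly p 0 \<noteq> 0" "poly q 1 \<noteq> 0"
    using assms(3,4) p[of 0] q[of 1] by simp_all
  then have "p * q \<noteq> 0" by auto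
  then obtain t where "poly (p * q) t \<noteq> 0"
    using poly_all_0_iff_0 by blast
  then show ?thesis by (intro that[of t]) (auto simp: p q)
qed

text \<open>A polynomial that has degree at most \<open>N\<close> in each variable and vanishes on a grid of side
  \<open>N + 1\<close> vanishes: the grid restriction is lifted from one variable after the other.\<close>

lemma vanishing_on_grid:
  fixes F :: "(nat \<Rightarrow> 'a::field_char_0) \<Rightarrow> 'a"
  assumes deg: "\<And>v j. \<exists>p. degree p \<le> N \<and> (\<forall>t. F (v(j := t)) = poly p t)"
    and "finite J"
    and "\<And>v. (\<And>j. j \<in> J \<Longrightarrow> v j \<in> of_nat ` {..N}) \<Longrightarrow> (\<And>j. j \<notin> J \<Longrightarrow> v j = v0 j) \<Longrightarrow> F v = 0"
    and "\<And>j. j \<notin> J \<Longrightarrow> v j = v0 j"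
  shows "F v = 0"
  using assms(2-)
proof (induction J arbitrary: v v0)
  case empty
  then show ?case by simp
next
  case (insert j J)
  obtain p where p: "degree p \<le> N" "\<And>t. F (v(j := t)) = poly p t" using deg by meson
  have roots: "of_nat ` {..N} \<subseteq> {t. poly p t = 0}"
  proof
    fix t :: 'a assume t: "t \<in> of_nat ` {..N}"
    have "F (v(j := t)) = 0"
    proof (rule insert.IH[of "v0(j := t)"])
      fix u assume u: "\<And>k. k \<in> J \<Longrightarrow> u k \<in> of_nat ` {..N}" "\<And>k. k \<notin> J \<Longrightarrow> u k = (v0(j := t)) k"
      show "F u = 0"
        using u t insert.hyps(2) by (intro insert.prems(1)) (auto split: if_splits)
    qed (use insert.prems in auto)
    then show "t \<in> {t. poly p t = 0}" using p by simp
  qed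
  have "p = 0"
  proof (rule ccontr)
    assume "p \<noteq> 0"
    have "Suc N = card (of_nat ` {..N} :: 'a set)"
      by (subst card_image) (auto simp: inj_on_def)
    also have "\<dots> \<le> card {t. poly p t = 0}"
      using roots \<open>p \<noteq> 0\<close> by (intro card_mono poly_roots_finite)
    also have "\<dots> \<le> degree p" using \<open>p \<noteq> 0\<close> by (rule card_poly_roots_bound)
    finally show False using p(1) by simp
  qed
  then show ?case using p(2)[of "v j"] by simp
qed

section \<open>Linear relations and lowest terms\<close>

lemma exists_linear_relation:
  fixes M :: "'n \<Rightarrow> 'p \<Rightarrow> 'k::field"
  assumes "finite P" "finite N" "card P < card N"
  shows "\<exists>c. (\<exists>n\<in>N. c n \<noteq> 0) \<and> (\<forall>p\<in>P. (\<Sum>n\<in>N. c n * M n p) = 0)"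
  using assms
proof (induction P arbitrary: N M)
  case empty
  then have "N \<noteq> {}" by auto
  then show ?case by (intro exI[of _ "\<lambda>_. 1"]) auto
next
  case (insert p P)
  show ?case
  proof (cases "\<forall>n\<in>N. M n p = 0")
    case True
    obtain c where "\<exists>n\<in>N. c n \<noteq> 0" "\<forall>p\<in>P. (\<Sum>n\<in>N. c n * M n p) = 0"
      using insert.IH[of N M] insert.prems insert.hyps by (auto simp: card_insert_if)
    then show ?thesis using True by (intro exI[of _ c]) (auto intro!: sum.neutral)
  next
    case False
    then obtain n0 where n0: "n0 \<in> N" "M n0 p \<noteq> 0" by blast
    (* One step of Gaussian elimination with pivot row n0 in column p. *)
    define N' where "N' = N - {n0}"
    define M' where "M' n r = M n r - M n p / M n0 p * M n0 r" for n r
    have "card P < card N'" "finite N'"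
      using insert.prems insert.hyps n0 by (auto simp: N'_def card_insert_if)
    then obtain c where c: "\<exists>n\<in>N'. c n \<noteq> 0" "\<forall>r\<in>P. (\<Sum>n\<in>N'. c n * M' n r) = 0"
      using insert.IH[of N' M'] by blast
    define c' where "c' n = (if n = n0 then - (\<Sum>n\<in>N'. c n * M n p / M n0 p) else c n)" for n
    have "(\<Sum>n\<in>N. c' n * M n r) = (\<Sum>n\<in>N'. c n * M' n r)" for r
    proof -
      have "(\<Sum>n\<in>N. c' n * M n r) = c' n0 * M n0 r + (\<Sum>n\<in>N'. c' n * M n r)"
        unfolding N'_def using n0 insert.prems(1) by (intro sum.remove)
      also have "(\<Sum>n\<in>N'. c' n * M n r) = (\<Sum>n\<in>N'. c n * M n r)"
        by (intro sum.cong) (auto simp: c'_def N'_def)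
      also have "c' n0 * M n0 r = - (\<Sum>n\<in>N'. c n * M n p / M n0 p * M n0 r)"
        by (simp add: c'_def sum_distrib_right)
      finally show ?thesis
        by (simp add: M'_def algebra_simps sum_subtractf)
    qed
    moreover have "M' n p = 0" for n using n0 by (simp add: M'_def)
    moreover have "\<exists>n\<in>N. c' n \<noteq> 0" using c(1) by (auto simp: c'_def N'_def)
    ultimately show ?thesis using c(2) by (intro exI[of _ c']) auto
  qed
qed

text \<open>Among terms with pairwise different vanishing orders at 0, the one with the lowest order
  cannot be cancelled.\<close>

lemma lowest_term_survives:
  fixes c :: "'n \<Rightarrow> 'a::field_char_0"
  assumes "finite N" "inj_on wt N" "\<exists>n\<in>N. c n \<noteq> 0" "\<And>n. n \<in> N \<Longrightarrow> poly (p n) 0 \<noteq> 0"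
  shows "\<exists>s. (\<Sum>n\<in>N. c n * (s ^ wt n * poly (p n) s)) \<noteq> 0"
proof -
  define P where "P = (\<Sum>n\<in>N. monom (c n) (wt n) * p n)"
  obtain k where k: "k \<in> N" "c k \<noteq> 0" and min: "\<And>n. n \<in> N \<Longrightarrow> c n \<noteq> 0 \<Longrightarrow> wt k \<le> wt n"
    using ex_has_least_nat[of "\<lambda>n. n \<in> N \<and> c n \<noteq> 0" _ wt] assms(3) by blast
  have "coeff P (wt k) = (\<Sum>n\<in>N. if n = k then c k * poly (p k) 0 else 0)"
    unfolding P_def coeff_sum
  proof (intro sum.cong refl)
    fix n assume n: "n \<in> N"
    show "coeff (monom (c n) (wt n) * p n) (wt k) = (if n = k then c k * poly (p k) 0 else 0)"
    proof (cases "n = k \<or> c n = 0")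
      case True
      then show ?thesis by (auto simp: coeff_monom_mult poly_0_coeff_0 k)
    next
      case False
      then have "wt k < wt n"
        using min[OF n] assms(2) n k(1) by (metis inj_onD le_neq_implies_less)
      then show ?thesis using False by (simp add: coeff_monom_mult)
    qed
  qed
  also have "\<dots> \<noteq> 0" using k assms(1,4) by simp
  finally have "P \<noteq> 0" by auto
  then obtain s where "poly P s \<noteq> 0" using poly_all_0_iff_0 by blast
  then show ?thesis
    by (intro exI[of _ s]) (simp add: P_def poly_sum poly_monom mult.assoc)
qed

lemma sum_digits: "(\<Sum>j<k. (n div b ^ j mod b) * b ^ j) = (n mod b ^ k :: nat)"
proof (induction k)
  case (Suc k)
  have "n mod b ^ Suc k = b ^ k * (n div b ^ k mod b) + n mod b ^ k"
    using mod_mult2_eq[of n "b ^ k" b] by (simp add: mult.commute)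
  then show ?case using Suc by simp
qed simp

section \<open>The gradient of a determinant at a matrix of corank one\<close>

lemma comm_ring_hom_eval_poly: "comm_ring_hom (\<lambda>p. poly p (t :: 'a::comm_ring_1))"
  by unfold_locales auto

text \<open>Replacing the first basis vector by the kernel vector \<open>v\<close> is a unimodular change of basis
  \<open>Q\<close>.  It turns \<open>N\<close> into a matrix with zero first row and column and the same remaining block,
  so the whole first row of the transformed pencil \<open>N + t E\<close> is divisible by \<open>t\<close>.  The quotient
  at \<open>t = 0\<close> is block triangular, with the value of the quadratic form of \<open>E\<close> at \<open>v\<close> in
  the corner.\<close>

lemma det_pencil:
  fixes N E :: "nat \<Rightarrow> nat \<Rightarrow> 'a::idom"
  assumes sym: "\<And>i j. i < Suc n \<Longrightarrow> j < Suc n \<Longrightarrow> N i j = N j i"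
    and v0: "v 0 = 1"
    and ker: "\<And>i. i < Suc n \<Longrightarrow> (\<Sum>j<Suc n. N i j * v j) = 0"
  defines "D \<equiv> det (mat (Suc n) (Suc n) (\<lambda>(i, j). [:N i j, E i j:]))"
  shows "poly D 0 = 0"
    and "poly (pderiv D) 0 =
      det (mat n n (\<lambda>(i, j). N (Suc i) (Suc j))) * (\<Sum>i<Suc n. \<Sum>j<Suc n. E i j * v i * v j)"
proof -
  let ?m = "Suc n"
  define P where "P = mat ?m ?m (\<lambda>(i, j). [:N i j, E i j:])"
  (* The columns of Q are the kernel vector and the later unit vectors; r is the first row of the
     transformed pencil divided by t, and R is the transformed pencil with this first row. *)
  define Q where "Q = mat ?m ?m (\<lambda>(i, j). if j = 0 then [:v i:] else if i = j then 1 else 0)"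
  define r where "r j = (if j = 0 then \<Sum>k<?m. v k * (\<Sum>l<?m. E k l * v l)
      else \<Sum>k<?m. v k * E k j)" for j
  define R where "R = mat ?m ?m (\<lambda>(i, j). if i = 0 then [:r j:]
      else if j = 0 then [:0, \<Sum>l<?m. E i l * v l:] else [:N i j, E i j:])"
  have carr [simp]: "P \<in> carrier_mat ?m ?m" "Q \<in> carrier_mat ?m ?m" "R \<in> carrier_mat ?m ?m"
    by (auto simp: P_def Q_def R_def)
  have sum_pCons: "(\<Sum>k\<in>K. [:f k, g k:]) = [:sum f K, sum g K:]" for f g :: "nat \<Rightarrow> 'a" and K
    by (induction K rule: infinite_finite_induct) auto
  have "det Q = prod_list (diag_mat Q)"
    by (rule det_lower_triangular[of ?m]) (auto simp: Q_def)
  also have "\<dots> = 1"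
    unfolding prod_list_diag_prod using v0 by (intro prod.neutral) (auto simp: Q_def one_pCons)
  finally have detQ: "det Q = 1" .
  have PQ: "(P * Q) $$ (k, j) = (if j = 0 then [:0, \<Sum>l<?m. E k l * v l:] else [:N k j, E k j:])"
    if "k < ?m" "j < ?m" for k j
  proof -
    have "(P * Q) $$ (k, j) = (\<Sum>l<?m. [:N k l, E k l:] * (if j = 0 then [:v l:] else if l = j then 1 else 0))"
      using that unfolding P_def Q_def
      by (auto simp: scalar_prod_def atLeast0LessThan simp del: sum.lessThan_Suc intro!: sum.cong)
    also have "\<dots> = (if j = 0 then \<Sum>l<?m. [:N k l * v l, E k l * v l:] else [:N k j, E k j:])"
    proof (cases "j = 0")
      case True
      then show ?thesis by (auto simp: mult.commute simp del: sum.lessThan_Suc intro!: sum.cong)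
    next
      case False
      have "(\<Sum>l<?m. [:N k l, E k l:] * (if j = 0 then [:v l:] else if l = j then 1 else 0)) =
          (\<Sum>l<?m. if l = j then [:N k j, E k j:] else 0)"
        using False by (intro sum.cong refl) (simp only: mult_1_right mult_zero_right if_False split: if_split, simp)
      then show ?thesis using that False by (simp del: sum.lessThan_Suc)
    qed
    finally show ?thesis unfolding sum_pCons using ker[OF that(1)] by (simp del: sum.lessThan_Suc)
  qed
  have QZ: "(transpose_mat Q * Z) $$ (i, j) = (\<Sum>k<?m. Q $$ (k, i) * Z $$ (k, j))"
    if "Z \<in> carrier_mat ?m ?m" "i < ?m" "j < ?m" for Z i j
    using that carr(2) by (auto simp: scalar_prod_def atLeast0LessThan
        simp del: sum.lessThan_Suc carr intro!: sum.cong)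
  have conj: "transpose_mat Q * (P * Q) = multrow 0 [:0, 1:] R"
  proof (rule eq_matI)
    fix i j assume "i < dim_row (multrow 0 [:0, 1:] R)" "j < dim_col (multrow 0 [:0, 1:] R)"
    then have ij: "i < ?m" "j < ?m" by (auto simp: R_def)
    have "(transpose_mat Q * (P * Q)) $$ (i, j) = (\<Sum>k<?m. Q $$ (k, i) * (P * Q) $$ (k, j))"
      by (intro QZ mult_carrier_mat[of _ _ ?m] carr ij)
    have Qk: "Q $$ (k, i) = (if i = 0 then [:v k:] else if k = i then 1 else 0)" if "k < ?m" for k
      using that ij by (simp add: Q_def)
    (* Column 0 of Q is v, the others are unit vectors. *)
    note \<open>(transpose_mat Q * (P * Q)) $$ (i, j) = _\<close>
    also have "(\<Sum>k<?m. Q $$ (k, i) * (P * Q) $$ (k, j)) = (if i = 0 then \<Sum>k<?m. [:v k:] * (P * Q) $$ (k, j) else (P * Q) $$ (i, j))"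
    proof (cases "i = 0")
      case True
      have "(\<Sum>k<?m. Q $$ (k, i) * (P * Q) $$ (k, j)) = (\<Sum>k<?m. [:v k:] * (P * Q) $$ (k, j))"
        by (intro sum.cong refl, subst Qk) (simp_all only: True if_True lessThan_iff refl)
      then show ?thesis using True by (auto simp del: sum.lessThan_Suc index_mult_mat)
    next
      case False
      have "(\<Sum>k<?m. Q $$ (k, i) * (P * Q) $$ (k, j)) = (\<Sum>k<?m. if k = i then (P * Q) $$ (i, j) else 0)"
        using False ij by (intro sum.cong) (auto simp: Qk simp del: index_mult_mat)
      then show ?thesis using False ij by (simp del: sum.lessThan_Suc index_mult_mat)
    qed
    also have "\<dots> = multrow 0 [:0, 1:] R $$ (i, j)"
    proof (cases "i = 0")
      case False
      then show ?thesis using ij by (simp add: PQ R_def)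
    next
      case True
      have "(\<Sum>k<?m. [:v k:] * (P * Q) $$ (k, j)) = [:0, r j:]"
      proof (cases "j = 0")
        case True
        have "(\<Sum>k<?m. [:v k:] * (P * Q) $$ (k, j)) = (\<Sum>k<?m. [:0, v k * (\<Sum>l<?m. E k l * v l):])"
          using True ij by (intro sum.cong) (auto simp: PQ simp del: sum.lessThan_Suc)
        then show ?thesis unfolding sum_pCons using True by (simp add: r_def del: sum.lessThan_Suc)
      next
        case False
        have "(\<Sum>k<?m. [:v k:] * (P * Q) $$ (k, j)) = (\<Sum>k<?m. [:v k * N k j, v k * E k j:])"
          using False ij by (intro sum.cong) (auto simp: PQ simp del: sum.lessThan_Suc)
        moreover have "(\<Sum>k<?m. v k * N k j) = 0"
        proof -
          have "(\<Sum>k<?m. v k * N k j) = (\<Sum>k<?m. N j k * v k)"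
            using ij by (intro sum.cong) (auto simp: sym[of _ j] mult.commute)
          then show ?thesis using ker[OF ij(2)] by simp
        qed
        ultimately show ?thesis unfolding sum_pCons using False by (simp add: r_def del: sum.lessThan_Suc)
      qed
      then show ?thesis using ij True by (simp add: R_def del: sum.lessThan_Suc)
    qed
    finally show "(transpose_mat Q * (P * Q)) $$ (i, j) = multrow 0 [:0, 1:] R $$ (i, j)" .
  qed (auto simp: R_def Q_def)
  have "det P = det (transpose_mat Q * (P * Q))"
    using detQ det_transpose[OF carr(2)] det_mult[OF carr(1,2)]
      det_mult[OF transpose_carrier_mat[THEN iffD2, OF carr(2)] mult_carrier_mat[OF carr(1,2)]]
    by simp
  then have D: "D = pCons 0 (det R)"
    unfolding conj by (simp add: det_multrow[of _ ?m] D_def P_def)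
  interpret ev: comm_ring_hom "\<lambda>p. poly p (0::'a)" by (rule comm_ring_hom_eval_poly)
  let ?B = "mat n n (\<lambda>(i, j). N (Suc i) (Suc j))"
  have "map_mat (\<lambda>p. poly p 0) R =
      four_block_mat (mat 1 1 (\<lambda>_. r 0)) (mat 1 n (\<lambda>(i, j). r (Suc j))) (0\<^sub>m n 1) ?B"
    by (rule eq_matI) (auto simp: R_def less_Suc_eq_0_disj)
  moreover have "det (four_block_mat (mat 1 1 (\<lambda>_. r 0)) (mat 1 n (\<lambda>(i, j). r (Suc j))) (0\<^sub>m n 1) ?B) =
      r 0 * det ?B"
    by (subst det_four_block_mat_lower_left_zero_col[where n = n]) (auto simp: det_single)
  ultimately have "det (map_mat (\<lambda>p. poly p 0) R) = r 0 * det ?B"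
    by (simp only:)
  then have "poly (det R) 0 = r 0 * det ?B" by simp
  moreover have "r 0 = (\<Sum>i<?m. \<Sum>j<?m. E i j * v i * v j)"
    by (simp add: r_def sum_distrib_left mult_ac del: sum.lessThan_Suc)
  ultimately show "poly (pderiv D) 0 = det ?B * (\<Sum>i<?m. \<Sum>j<?m. E i j * v i * v j)"
    by (simp add: D pderiv_pCons mult.commute del: sum.lessThan_Suc)
  show "poly D 0 = 0" by (simp add: D)
qed

text \<open>The derivative of \<open>A\<close> with respect to the variable \<open>w\<close>.\<close>

definition position :: "('v, 'k::zero_neq_one) mpoly mat \<Rightarrow> 'v \<Rightarrow> nat \<Rightarrow> nat \<Rightarrow> 'a::zero_neq_one" where
  "position A w i j = (if A $$ (i, j) = Var w then 1 else 0)"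

definition position_form ::
  "('v, 'k::zero_neq_one) mpoly mat \<Rightarrow> 'v \<Rightarrow> (nat \<Rightarrow> 'a::comm_ring_1) \<Rightarrow> 'a" where
  "position_form A w v = (\<Sum>i<dim_row A. \<Sum>j<dim_col A. position A w i j * v i * v j)"

definition variable_or_zero :: "('v, 'k::zero_neq_one) mpoly mat \<Rightarrow> bool" where
  "variable_or_zero A \<longleftrightarrow> (\<forall>i<dim_row A. \<forall>j<dim_col A. A $$ (i, j) = 0 \<or> (\<exists>w. A $$ (i, j) = Var w))"

text \<open>A symmetric matrix of corank one has a multiple of \<open>v v\<^sup>T\<close> as its adjugate, where \<open>v\<close> spans
  the kernel.  Hence the gradient of the determinant is proportional to the vector of position
  forms of \<open>v\<close>, and it depends on the point only through its kernel.\<close>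

lemma gradient_det:
  fixes h :: "'k::comm_ring_1 \<Rightarrow> 'a::idom" and A :: "('v, 'k) mpoly mat"
  assumes hom: "comm_ring_hom h"
    and A: "A \<in> carrier_mat (Suc n) (Suc n)" "variable_or_zero A"
    and sym: "\<And>i j. i < Suc n \<Longrightarrow> j < Suc n \<Longrightarrow> A $$ (i, j) = A $$ (j, i)"
    and v0: "v 0 = 1"
    and ker: "\<And>i. i < Suc n \<Longrightarrow> (\<Sum>j<Suc n. eval_mpoly h a (A $$ (i, j)) * v j) = 0"
  shows "eval_mpoly h a (det A) = 0"
    and "eval_mpoly h a (partial_deriv w (det A)) =
      det (mat n n (\<lambda>(i, j). eval_mpoly h a (A $$ (Suc i, Suc j)))) * position_form A w v"
proof -
  interpret h: comm_ring_hom h by (rule hom)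
  let ?h' = "\<lambda>c. [:h c:]"
  have hom': "comm_ring_hom ?h'"
    by unfold_locales (auto simp: h.hom_add h.hom_mult one_pCons)
  let ?y = "\<lambda>v. [:a v, if v = w then 1 else 0:]"
  interpret e: comm_ring_hom "eval_mpoly ?h' ?y" by (rule comm_ring_hom_eval_mpoly[OF hom'])
  have dim [simp]: "dim_row A = Suc n" "dim_col A = Suc n" using A by auto
  have "map_mat (eval_mpoly ?h' ?y) A =
      mat (Suc n) (Suc n) (\<lambda>(i, j). [:eval_mpoly h a (A $$ (i, j)), position A w i j:])"
  proof (rule eq_matI)
    fix i j
    assume "i < dim_row (mat (Suc n) (Suc n) (\<lambda>(i, j). [:eval_mpoly h a (A $$ (i, j)), position A w i j:]))"
      and "j < dim_col (mat (Suc n) (Suc n) (\<lambda>(i, j). [:eval_mpoly h a (A $$ (i, j)), position A w i j:]))"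
    then have ij: "i < Suc n" "j < Suc n" by auto
    have Vn: "Var w \<noteq> (0 :: ('v, 'k) mpoly)" by (rule Var_neq_0)
    show "map_mat (eval_mpoly ?h' ?y) A $$ (i, j) =
        mat (Suc n) (Suc n) (\<lambda>(i, j). [:eval_mpoly h a (A $$ (i, j)), position A w i j:]) $$ (i, j)"
      using ij A(2)[unfolded variable_or_zero_def, rule_format, of i j] Vn
      by (auto simp: position_def one_pCons)
  qed auto
  then have D: "eval_mpoly ?h' ?y (det A) =
      det (mat (Suc n) (Suc n) (\<lambda>(i, j). [:eval_mpoly h a (A $$ (i, j)), position A w i j:]))"
    by (metis e.hom_det)
  note pencil = det_pencil[where N = "\<lambda>i j. eval_mpoly h a (A $$ (i, j))" and E = "position A w"
      and v = v and n = n, OF _ v0 ker, folded D]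
  have sym': "eval_mpoly h a (A $$ (i, j)) = eval_mpoly h a (A $$ (j, i))" if "i < Suc n" "j < Suc n" for i j
    using sym[OF that] by simp
  show "eval_mpoly h a (det A) = 0"
    using pencil(1)[OF sym'] by (simp add: poly_eval_mpoly)
  show "eval_mpoly h a (partial_deriv w (det A)) =
      det (mat n n (\<lambda>(i, j). eval_mpoly h a (A $$ (Suc i, Suc j)))) * position_form A w v"
    unfolding eval_partial_deriv[OF hom] using pencil(2)[OF sym'] by (simp add: position_form_def)
qed

text \<open>Reversing the columns makes the matrix lower triangular with ones on the diagonal.\<close>

lemma det_antitriangular_ne_0:
  fixes B :: "'a::idom mat"
  assumes B: "B \<in> carrier_mat n n"
    and zero: "\<And>i j. i < n \<Longrightarrow> j < n \<Longrightarrow> Suc (i + j) < n \<Longrightarrow> B $$ (i, j) = 0"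
    and one: "\<And>i j. i < n \<Longrightarrow> j < n \<Longrightarrow> Suc (i + j) = n \<Longrightarrow> B $$ (i, j) = 1"
  shows "det B \<noteq> 0"
proof -
  define J :: "'a mat" where "J = mat n n (\<lambda>(i, j). if Suc (i + j) = n then 1 else 0)"
  have J: "J \<in> carrier_mat n n" by (simp add: J_def)
  have BJ: "(B * J) $$ (i, j) = B $$ (i, n - Suc j)" if "i < n" "j < n" for i j
  proof -
    have "(B * J) $$ (i, j) = (\<Sum>k<n. B $$ (i, k) * (if Suc (k + j) = n then 1 else 0))"
      using that B by (auto simp: J_def scalar_prod_def atLeast0LessThan intro!: sum.cong)
    also have "\<dots> = (\<Sum>k<n. if k = n - Suc j then B $$ (i, k) else 0)"
      using that by (intro sum.cong) auto
    finally show ?thesis using that by simp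
  qed
  have "det (B * J) = prod_list (diag_mat (B * J))"
  proof (rule det_lower_triangular)
    show "B * J \<in> carrier_mat n n" using B J by simp
    show "(B * J) $$ (i, j) = 0" if "i < j" "j < n" for i j
      using that by (simp add: BJ zero)
  qed
  also have "\<dots> = 1"
    unfolding prod_list_diag_prod using B J by (intro prod.neutral) (auto simp: BJ one simp del: index_mult_mat(1))
  finally show ?thesis using det_mult[OF B J] by auto
qed

section \<open>Matrices in the ladder with a given kernel\<close>

lemma poly_position_form:
  fixes y :: "nat \<Rightarrow> 'a::comm_ring_1 poly"
  shows "poly (position_form A w y) t = position_form A w (\<lambda>i. poly (y i) t)"
proof -
  have "poly (position A w i j) t = position A w i j" for i j
    by (simp add: position_def)
  then show ?thesis by (simp add: position_form_def poly_sum)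
qed

lemma position_form_on_line:
  "position_form A w (\<lambda>i. v i + t * u i) = poly (position_form A w (\<lambda>i. [:v i, u i:])) t"
  by (simp add: poly_position_form)

lemma polynomial_on_lines_position_form: "polynomial_on_lines (position_form A w)"
  unfolding polynomial_on_lines_def
  by (intro allI, rule exI, rule allI, rule position_form_on_line)

text \<open>The properties of an \<open>(m + 2)\<close>-ladderlike degeneration that matter, for \<open>m = n + 1\<close> and with
  indices from 0: the variables up to the antidiagonal just below the main one are
  kept, while below it entries may vanish or repeat variables of the whole matrix.\<close>

locale ladder_matrix =
  fixes n :: nat and A :: "(nat \<times> nat, 'k::field_char_0) mpoly mat"
  assumes carrier: "A \<in> carrier_mat (Suc n) (Suc n)"
    and entries: "\<And>i j. i < Suc n \<Longrightarrow> j < Suc n \<Longrightarrow>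
        A $$ (i, j) = 0 \<or> (\<exists>w \<in> sym_vars (Suc n). A $$ (i, j) = Var w)"
    and symmetric: "\<And>i j. i < Suc n \<Longrightarrow> j < Suc n \<Longrightarrow> A $$ (i, j) = A $$ (j, i)"
    and ladder: "\<And>i j. i < Suc n \<Longrightarrow> j < Suc n \<Longrightarrow> i + j \<le> Suc n \<Longrightarrow>
        A $$ (i, j) = Var (min (Suc i) (Suc j), max (Suc i) (Suc j))"
begin

lemma dim [simp]: "dim_row A = Suc n" "dim_col A = Suc n"
  using carrier by auto

lemma variable_or_zero_A: "variable_or_zero A"
  using entries unfolding variable_or_zero_def dim by blast

lemma position_sym:
  assumes "i < Suc n" "j < Suc n"
  shows "position A w i j = position A w j i"
  using symmetric[OF assms] by (simp add: position_def)

lemma position_first_row: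
  assumes "j < Suc n"
  shows "position A w 0 j = (if w = (1, Suc j) then 1 else 0)"
  using ladder[of 0 j] assms by (auto simp: position_def)

text \<open>The first row consists of the variables \<open>(1, j)\<close>, so apart from the first row and column
  only products of later coordinates contribute to \<open>position_form A (1, j)\<close>.\<close>

lemma position_form_first_row:
  fixes v :: "nat \<Rightarrow> 'a::comm_ring_1"
  assumes "j < Suc n"
  shows "position_form A (1, Suc j) v = (if j = 0 then v 0 ^ 2 else 2 * v 0 * v j) +
     (\<Sum>a=1..n. \<Sum>b=1..n. position A (1, Suc j) a b * v a * v b)"
proof -
  let ?p = "position A (1, Suc j)"
  have split: "(\<Sum>i<Suc n. f i) = f 0 + (\<Sum>i=1..n. f i)" for f :: "nat \<Rightarrow> 'a"
    by (simp only: sum.lessThan_Suc_shift sum.atLeast1_atMost_eq One_nat_def)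
  have row: "(\<Sum>b=1..n. ?p 0 b * v 0 * v b) = (if j = 0 then 0 else v 0 * v j)"
  proof -
    have "(\<Sum>b=1..n. ?p 0 b * v 0 * v b) = (\<Sum>b=1..n. if b = j then v 0 * v j else 0)"
      by (intro sum.cong) (auto simp: position_first_row)
    then show ?thesis using assms by auto
  qed
  have col: "(\<Sum>a=1..n. ?p a 0 * v a * v 0) = (if j = 0 then 0 else v 0 * v j)"
  proof -
    have "(\<Sum>a=1..n. ?p a 0 * v a * v 0) = (\<Sum>a=1..n. ?p 0 a * v 0 * v a)"
      by (intro sum.cong) (auto simp: position_sym[of _ 0] mult_ac)
    then show ?thesis using row by simp
  qed
  have "position_form A (1, Suc j) v = ?p 0 0 * v 0 * v 0 + (\<Sum>b=1..n. ?p 0 b * v 0 * v b) +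
      ((\<Sum>a=1..n. ?p a 0 * v a * v 0) + (\<Sum>a=1..n. \<Sum>b=1..n. ?p a b * v a * v b))"
    unfolding position_form_def dim split by (simp only: sum.distrib)
  also have "?p 0 0 = (if j = 0 then 1 else 0)"
    by (simp add: position_first_row)
  finally show ?thesis unfolding row col
    by (simp add: power2_eq_square algebra_simps)
qed

text \<open>The last antidiagonal of the ladder, which is the main antidiagonal of the block without the
  first row and column.  The condition \<open>2 \<le> i\<close> keeps \<open>j\<close> at most \<open>n + 1\<close>.\<close>

definition antidiagonal :: "(nat \<times> nat) set" where
  "antidiagonal = {(i, j). 2 \<le> i \<and> i \<le> j \<and> i + j = n + 3}"

text \<open>A matrix with a prescribed kernel vector \<open>v\<close> is constructed by fixing a common value on
  \<open>antidiagonal\<close>, setting the other variables outside the first row to 0, and solving for the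
  first row.  Since variables of the first row may occur elsewhere too, this is a linear system,
  whose coefficients are the entries of \<open>kernel_system v\<close>.\<close>

definition position_row :: "nat \<times> nat \<Rightarrow> nat \<Rightarrow> (nat \<Rightarrow> 'a::comm_ring_1) \<Rightarrow> 'a" where
  "position_row w i v = (\<Sum>j<Suc n. position A w i j * v j)"

definition kernel_system :: "(nat \<Rightarrow> 'a::comm_ring_1) \<Rightarrow> 'a mat" where
  "kernel_system v = mat (Suc n) (Suc n) (\<lambda>(i, j). position_row (1, Suc j) i v)"

definition kernel_rhs :: "(nat \<Rightarrow> 'a::comm_ring_1) \<Rightarrow> 'a vec" where
  "kernel_rhs v = vec (Suc n) (\<lambda>i. \<Sum>w\<in>antidiagonal. position_row w i v)"

text \<open>Cramer's rule for the linear system.  Taking the determinant of the system as the value on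
  \<open>antidiagonal\<close> clears the denominators, so that the point depends polynomially on \<open>v\<close>.\<close>

definition kernel_point :: "(nat \<Rightarrow> 'a::comm_ring_1) \<Rightarrow> nat \<times> nat \<Rightarrow> 'a" where
  "kernel_point v w =
    (if fst w = 1 \<and> snd w \<in> {1..Suc n} then - (\<Sum>l<Suc n. adj_mat (kernel_system v) $$ (snd w - 1, l) * kernel_rhs v $ l)
     else if w \<in> antidiagonal then det (kernel_system v) else 0)"

lemma finite_sym_vars: "finite (sym_vars m)"
  by (rule finite_subset[of _ "{..m} \<times> {..m}"]) (auto simp: sym_vars_def)

lemma antidiagonal_subset: "antidiagonal \<subseteq> sym_vars (Suc n)"
  by (auto simp: antidiagonal_def sym_vars_def)

lemma eval_entry:
  fixes h :: "'k \<Rightarrow> 'a::comm_ring_1"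
  assumes hom: "comm_ring_hom h" and ij: "i < Suc n" "j < Suc n"
  shows "eval_mpoly h a (A $$ (i, j)) = (\<Sum>w\<in>sym_vars (Suc n). a w * position A w i j)"
proof -
  interpret h: comm_ring_hom h by (rule hom)
  consider "A $$ (i, j) = 0" | w where "w \<in> sym_vars (Suc n)" "A $$ (i, j) = Var w"
    using entries[OF ij] by blast
  then show ?thesis
  proof cases
    case 1
    then have "position A w i j = (0::'a)" for w
      using Var_neq_0[of w, where 'a = 'k] by (simp add: position_def)
    then show ?thesis using 1 by simp
  next
    case (2 w)
    then have "(\<Sum>w\<in>sym_vars (Suc n). a w * position A w i j) = (\<Sum>w'\<in>sym_vars (Suc n). if w' = w then a w else 0)"
      by (intro sum.cong) (auto simp: position_def)
    then show ?thesis using 2 finite_sym_vars by simp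
  qed
qed

lemma eval_row:
  fixes h :: "'k \<Rightarrow> 'a::comm_ring_1"
  assumes hom: "comm_ring_hom h" and i: "i < Suc n"
  shows "(\<Sum>j<Suc n. eval_mpoly h a (A $$ (i, j)) * v j) =
      (\<Sum>w\<in>sym_vars (Suc n). a w * position_row w i v)"
proof -
  have "(\<Sum>j<Suc n. eval_mpoly h a (A $$ (i, j)) * v j) =
      (\<Sum>j<Suc n. \<Sum>w\<in>sym_vars (Suc n). a w * position A w i j * v j)"
    using i by (intro sum.cong) (auto simp: eval_entry[OF hom] sum_distrib_right)
  then show ?thesis
    by (subst (asm) sum.swap) (simp add: position_row_def sum_distrib_left mult.assoc del: sum.lessThan_Suc)
qed

text \<open>The product of a matrix with its adjugate is its determinant times the identity, so the
  contribution of the first-row variables cancels that of the antidiagonal.\<close>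

lemma kernel_point_kernel:
  fixes h :: "'k \<Rightarrow> 'a::comm_ring_1"
  assumes hom: "comm_ring_hom h" and i: "i < Suc n"
  shows "(\<Sum>j<Suc n. eval_mpoly h (kernel_point v) (A $$ (i, j)) * v j) = 0"
proof -
  let ?M = "kernel_system v" and ?c = "kernel_rhs v"
  have M: "?M \<in> carrier_mat (Suc n) (Suc n)" by (simp add: kernel_system_def)
  define F where "F = (\<lambda>j. (1::nat, Suc j)) ` {..<Suc n}"
  have disj: "F \<inter> antidiagonal = {}" by (auto simp: F_def antidiagonal_def)
  have sub: "F \<union> antidiagonal \<subseteq> sym_vars (Suc n)"
    using antidiagonal_subset by (auto simp: F_def sym_vars_def)
  have fin: "finite F" "finite antidiagonal"
    using sub finite_sym_vars finite_subset by blast+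
  let ?y = "\<lambda>j. \<Sum>l<Suc n. adj_mat ?M $$ (j, l) * ?c $ l"
  have "(\<Sum>w\<in>sym_vars (Suc n). kernel_point v w * position_row w i v) =
      (\<Sum>w\<in>F \<union> antidiagonal. kernel_point v w * position_row w i v)"
  proof (rule sum.mono_neutral_right[OF finite_sym_vars sub], intro ballI)
    fix w assume w: "w \<in> sym_vars (Suc n) - (F \<union> antidiagonal)"
    have "w \<in> F" if "fst w = 1" "snd w \<in> {1..Suc n}"
      unfolding F_def using that by (intro image_eqI[of _ _ "snd w - 1"]) (auto simp: prod_eq_iff)
    then show "kernel_point v w * position_row w i v = 0"
      using w by (auto simp: kernel_point_def)
  qed
  also have "\<dots> = (\<Sum>w\<in>F. kernel_point v w * position_row w i v) +
      (\<Sum>w\<in>antidiagonal. kernel_point v w * position_row w i v)"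
    using fin disj by (rule sum.union_disjoint)
  also have "(\<Sum>w\<in>F. kernel_point v w * position_row w i v) = - (\<Sum>j<Suc n. ?M $$ (i, j) * ?y j)"
  proof -
    have "(\<Sum>w\<in>F. kernel_point v w * position_row w i v) =
        (\<Sum>j<Suc n. kernel_point v (1, Suc j) * position_row (1, Suc j) i v)"
      unfolding F_def by (subst sum.reindex) (auto simp: inj_on_def)
    also have "\<dots> = (\<Sum>j<Suc n. - (?M $$ (i, j) * ?y j))"
      using i by (intro sum.cong refl) (simp add: kernel_point_def kernel_system_def mult.commute del: sum.lessThan_Suc)
    finally show ?thesis by (simp only: sum_negf)
  qed
  also have "(\<Sum>w\<in>antidiagonal. kernel_point v w * position_row w i v) = det ?M * ?c $ i"
    using i by (auto simp: kernel_rhs_def sum_distrib_left kernel_point_def antidiagonal_def intro!: sum.cong)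
  also have "(\<Sum>j<Suc n. ?M $$ (i, j) * ?y j) = (\<Sum>l<Suc n. (?M * adj_mat ?M) $$ (i, l) * ?c $ l)"
  proof -
    have "(\<Sum>j<Suc n. ?M $$ (i, j) * ?y j) = (\<Sum>l<Suc n. \<Sum>j<Suc n. ?M $$ (i, j) * adj_mat ?M $$ (j, l) * ?c $ l)"
      by (subst sum.swap) (simp add: sum_distrib_left mult.assoc del: sum.lessThan_Suc)
    also have "\<dots> = (\<Sum>l<Suc n. (?M * adj_mat ?M) $$ (i, l) * ?c $ l)"
      using i M adj_mat(1)[OF M]
      by (intro sum.cong refl) (auto simp: scalar_prod_def sum_distrib_right atLeast0LessThan simp del: sum.lessThan_Suc intro!: sum.cong)
    finally show ?thesis .
  qed
  also have "\<dots> = (\<Sum>l<Suc n. if l = i then det ?M * ?c $ i else 0)"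
    unfolding adj_mat(2)[OF M] using i by (intro sum.cong) auto
  also have "\<dots> = det ?M * ?c $ i" using i by (simp del: sum.lessThan_Suc)
  finally show ?thesis unfolding eval_row[OF hom i] by simp
qed

lemma polynomial_on_lines_position_row: "polynomial_on_lines (position_row w i)"
  unfolding position_row_def by (intro polynomial_on_lines_sum polynomial_on_lines_mult) auto

lemma polynomial_on_lines_kernel_point: "polynomial_on_lines (\<lambda>v. kernel_point v w)"
proof -
  have M: "kernel_system v \<in> carrier_mat (Suc n) (Suc n)" for v :: "nat \<Rightarrow> 'a"
    by (simp add: kernel_system_def)
  have Mij: "polynomial_on_lines (\<lambda>v. (kernel_system v :: 'a mat) $$ (i, j))" if "i < Suc n" "j < Suc n" for i j
    using that by (simp add: kernel_system_def polynomial_on_lines_position_row)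
  have adj: "polynomial_on_lines (\<lambda>v. (adj_mat (kernel_system v) :: 'a mat) $$ (i, j))" if "i < Suc n" "j < Suc n" for i j
    using polynomial_on_lines_adj_mat[OF M Mij that] .
  have c: "polynomial_on_lines (\<lambda>v. (kernel_rhs v :: 'a vec) $ l)" if "l < Suc n" for l
    using that by (auto simp: kernel_rhs_def intro!: polynomial_on_lines_position_row)
  have det: "polynomial_on_lines (\<lambda>v. det (kernel_system v :: 'a mat))"
    using polynomial_on_lines_det[OF M Mij] .
  consider "fst w = 1 \<and> snd w \<in> {1..Suc n}" | "\<not> (fst w = 1 \<and> snd w \<in> {1..Suc n})" "w \<in> antidiagonal"
    | "\<not> (fst w = 1 \<and> snd w \<in> {1..Suc n})" "w \<notin> antidiagonal" by blast
  then show ?thesis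
  proof cases
    case 1
    then have "snd w - 1 < Suc n" by auto
    then show ?thesis unfolding kernel_point_def if_P[OF 1]
      by (intro polynomial_on_lines_uminus polynomial_on_lines_sum polynomial_on_lines_mult adj c) auto
  next
    case 2
    show ?thesis unfolding kernel_point_def if_not_P[OF 2(1)] if_P[OF 2(2)] by (rule det)
  next
    case 3
    show ?thesis unfolding kernel_point_def if_not_P[OF 3(1)] if_not_P[OF 3(2)] by auto
  qed
qed

text \<open>The block without the first row and column; if it is invertible, a matrix with a kernel vector
  has corank one.\<close>

definition core :: "('k \<Rightarrow> 'a) \<Rightarrow> (nat \<times> nat \<Rightarrow> 'a::comm_ring_1) \<Rightarrow> 'a mat" where
  "core h a = mat n n (\<lambda>(i, j). eval_mpoly h a (A $$ (Suc i, Suc j)))"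

text \<open>The open condition on \<open>v\<close> under which the matrix \<open>kernel_point v\<close> is a smooth point of the
  hypersurface; the second factor keeps the gradient away from zero.\<close>

definition genericity :: "('k \<Rightarrow> 'a) \<Rightarrow> (nat \<Rightarrow> 'a::comm_ring_1) \<Rightarrow> 'a" where
  "genericity h v = det (core h (kernel_point v)) * position_form A (1, 1) v"

lemma polynomial_on_lines_genericity:
  assumes hom: "comm_ring_hom h"
  shows "polynomial_on_lines (genericity h)"
proof -
  have "polynomial_on_lines (\<lambda>v. det (core h (kernel_point v)))"
  proof (rule polynomial_on_lines_det[where n = n])
    fix i j assume ij: "i < n" "j < n"
    then have "core h (kernel_point v) $$ (i, j) =
        (\<Sum>w\<in>sym_vars (Suc n). kernel_point v w * position A w (Suc i) (Suc j))" for v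
      using eval_entry[OF hom, of "Suc i" "Suc j" "kernel_point v"] ij by (simp add: core_def)
    then show "polynomial_on_lines (\<lambda>v. core h (kernel_point v) $$ (i, j))"
      by (simp only:) (intro polynomial_on_lines_sum polynomial_on_lines_mult
          polynomial_on_lines_kernel_point polynomial_on_lines_const)
  qed (simp add: core_def)
  then show ?thesis
    unfolding genericity_def by (intro polynomial_on_lines_mult polynomial_on_lines_position_form)
qed

definition e0 :: "nat \<Rightarrow> 'a::zero_neq_one" where
  "e0 i = (if i = 0 then 1 else 0)"

text \<open>At the first unit vector the linear system is the identity with right-hand side 0, and the
  core is antitriangular.\<close>

lemma genericity_e0:
  fixes h :: "'k \<Rightarrow> 'a::idom"
  assumes hom: "comm_ring_hom h"
  shows "genericity h e0 \<noteq> 0"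
proof -
  interpret h: comm_ring_hom h by (rule hom)
  have row: "position_row w i (e0 :: nat \<Rightarrow> 'a) = (if w = (1, Suc i) then 1 else 0)" if "i < Suc n" for w i
  proof -
    have "position_row w i (e0 :: nat \<Rightarrow> 'a) = (\<Sum>j<Suc n. if j = 0 then position A w i 0 else 0)"
      unfolding position_row_def e0_def by (intro sum.cong) auto
    also have "\<dots> = position A w i 0" by (simp del: sum.lessThan_Suc)
    finally show ?thesis using position_sym[of i 0 w] that by (simp add: position_first_row)
  qed
  have sys: "kernel_system (e0 :: nat \<Rightarrow> 'a) = 1\<^sub>m (Suc n)"
    by (rule eq_matI) (auto simp: kernel_system_def row)
  have rhs: "kernel_rhs (e0 :: nat \<Rightarrow> 'a) $ i = 0" if "i < Suc n" for i
    using that by (auto simp: kernel_rhs_def row antidiagonal_def intro!: sum.neutral)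
  have point: "kernel_point (e0 :: nat \<Rightarrow> 'a) w = (if w \<in> antidiagonal then 1 else 0)" for w
    by (auto simp: kernel_point_def sys rhs antidiagonal_def simp del: sum.lessThan_Suc)
  have "det (core h (kernel_point e0)) \<noteq> (0::'a)"
  proof (rule det_antitriangular_ne_0[where n = n])
    fix i j assume ij: "i < n" "j < n"
    {
      assume "Suc (i + j) < n"
      then show "core h (kernel_point e0) $$ (i, j) = 0"
        using ij by (auto simp: core_def ladder point antidiagonal_def min_def max_def)
    next
      assume "Suc (i + j) = n"
      then show "core h (kernel_point e0) $$ (i, j) = 1"
        using ij by (auto simp: core_def ladder point antidiagonal_def min_def max_def)
    }
  qed (simp add: core_def)
  moreover have "position_form A (1, 1) (e0 :: nat \<Rightarrow> 'a) = 1"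
    using position_form_first_row[of 0 e0] by (simp add: e0_def)
  ultimately show ?thesis by (simp add: genericity_def)
qed

end

section \<open>Irreducible closures and chains\<close>

lemma comm_ring_hom_to_ac: "comm_ring_hom (to_ac :: 'k::field \<Rightarrow> 'k alg_closure)"
  by unfold_locales auto

lemma self_in_proj_point: "a \<in> proj_point a"
  unfolding proj_point_def by (intro CollectI exI[of _ 1]) simp

lemma vanishes_at_proj_point:
  assumes "homogeneous d g"
  shows "vanishes_at g (proj_point a) \<longleftrightarrow> eval_mpoly to_ac a g = 0"
proof -
  have "a \<in> proj_point a" by (rule self_in_proj_point)
  then show ?thesis
    by (auto simp: vanishes_at_def proj_point_def eval_mpoly_homogeneous_scale[OF assms])
qed

lemma proj_point_nonempty: "proj_point a \<noteq> {}"
  using self_in_proj_point by blast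

lemma topspace_zariski: "topspace (zariski E :: ('v \<Rightarrow> 'k::field alg_closure) set topology) = proj_space E"
proof -
  interpret ev: comm_ring_hom "eval_mpoly to_ac a" for a :: "'v \<Rightarrow> 'k alg_closure"
    by (rule comm_ring_hom_eval_mpoly[OF comm_ring_hom_to_ac])
  have "\<not> vanishes_at (1 :: ('v, 'k) mpoly) p" if "p \<in> proj_space E" for p
    using that proj_point_nonempty by (auto simp: proj_space_def vanishes_at_def)
  moreover have "(1 :: ('v, 'k) mpoly) \<in> polys_in E" "homogeneous 0 (1 :: ('v, 'k) mpoly)"
    by (auto simp: polys_in_def homogeneous_def)
  ultimately have "proj_space E \<in> {{p \<in> proj_space E. \<not> vanishes_at g p} | g :: ('v, 'k) mpoly.
        g \<in> polys_in E \<and> (\<exists>d. homogeneous d g)}"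
    by (intro CollectI exI[of _ "1 :: ('v, 'k) mpoly"]) auto
  then show ?thesis unfolding zariski_def topology_generated_by_topspace by auto
qed

lemma closedin_zariski_vanishing:
  fixes g :: "('v, 'k::field) mpoly"
  assumes "g \<in> polys_in E" "homogeneous d g"
  shows "closedin (zariski E) {p \<in> proj_space E. vanishes_at g p}"
proof -
  have "openin (zariski E) {p \<in> proj_space E. \<not> vanishes_at g p}"
    unfolding zariski_def using assms by (intro topology_generated_by_Basis) auto
  moreover have "proj_space E - {p \<in> proj_space E. vanishes_at g p} = {p \<in> proj_space E. \<not> vanishes_at g p}"
    by auto
  ultimately show ?thesis by (simp add: closedin_def topspace_zariski)
qed

lemma polynomial_on_lines_eval_mpoly:
  assumes "\<And>w. polynomial_on_lines (\<lambda>v. \<Phi> v w)"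
  shows "polynomial_on_lines (\<lambda>v. eval_mpoly h (\<Phi> v) g)"
  unfolding eval_mpoly_def
  by (intro polynomial_on_lines_sum polynomial_on_lines_mult polynomial_on_lines_prod
      polynomial_on_lines_power polynomial_on_lines_const assms)

text \<open>The preimage of a Zariski open set under a polynomial map contains a principal open
  neighbourhood of each of its points.\<close>

lemma zariski_open_pullback:
  fixes \<Phi> :: "(nat \<Rightarrow> 'k::field alg_closure) \<Rightarrow> 'v \<Rightarrow> 'k alg_closure"
  assumes pol: "\<And>w. polynomial_on_lines (\<lambda>v. \<Phi> v w)"
    and coord: "\<And>v. \<Phi> v \<in> coord_space E"
    and U: "openin (zariski E) U" "proj_point (\<Phi> v) \<in> U"
  shows "\<exists>F. polynomial_on_lines F \<and> F v \<noteq> 0 \<and>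
    (\<forall>u. F u \<noteq> 0 \<longrightarrow> \<Phi> u \<noteq> (\<lambda>_. 0) \<longrightarrow> proj_point (\<Phi> u) \<in> U)"
  using openin_topology_generated_by[OF U(1)[unfolded zariski_def]] U(2)
proof (induction U)
  case Empty
  then show ?case by simp
next
  case (Int U1 U2)
  obtain F1 F2 where "polynomial_on_lines F1" "F1 v \<noteq> 0"
      "\<forall>u. F1 u \<noteq> 0 \<longrightarrow> \<Phi> u \<noteq> (\<lambda>_. 0) \<longrightarrow> proj_point (\<Phi> u) \<in> U1"
    "polynomial_on_lines F2" "F2 v \<noteq> 0"
      "\<forall>u. F2 u \<noteq> 0 \<longrightarrow> \<Phi> u \<noteq> (\<lambda>_. 0) \<longrightarrow> proj_point (\<Phi> u) \<in> U2"
    using Int by blast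
  then show ?case by (intro exI[of _ "\<lambda>v. F1 v * F2 v"]) auto
next
  case (UN \<K>)
  then obtain V where "V \<in> \<K>" "proj_point (\<Phi> v) \<in> V" by blast
  with UN.IH[of V] obtain F where "polynomial_on_lines F" "F v \<noteq> 0"
      "\<forall>u. F u \<noteq> 0 \<longrightarrow> \<Phi> u \<noteq> (\<lambda>_. 0) \<longrightarrow> proj_point (\<Phi> u) \<in> V"
    by blast
  then show ?case using \<open>V \<in> \<K>\<close> by (intro exI[of _ F]) blast
next
  case (Basis U)
  then obtain g :: "('v, 'k) mpoly" and d where g: "U = {p \<in> proj_space E. \<not> vanishes_at g p}" "homogeneous d g"
    by blast
  have "proj_point (\<Phi> u) \<in> proj_space E" if "\<Phi> u \<noteq> (\<lambda>_. 0)" for u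
    using that coord unfolding proj_space_def by blast
  then show ?case using Basis.prems polynomial_on_lines_eval_mpoly[of \<Phi>, OF pol]
    by (intro exI[of _ "\<lambda>v. eval_mpoly to_ac (\<Phi> v) g"]) (auto simp: g(1) vanishes_at_proj_point[OF g(2)])
qed

lemma irreducible_space_closure:
  assumes S: "S \<subseteq> topspace T" "S \<noteq> {}"
    and meet: "\<And>U1 U2. openin T U1 \<Longrightarrow> openin T U2 \<Longrightarrow> U1 \<inter> S \<noteq> {} \<Longrightarrow> U2 \<inter> S \<noteq> {} \<Longrightarrow> U1 \<inter> U2 \<inter> S \<noteq> {}"
  shows "irreducible_space (subtopology T (T closure_of S))"
proof -
  let ?C = "T closure_of S"
  have C: "topspace (subtopology T ?C) = ?C" "S \<subseteq> ?C" "closedin T ?C"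
    using closure_of_subset[OF S(1)] closure_of_subset_topspace[of T S] by auto
  have "A = ?C \<or> B = ?C" if AB: "closedin T A" "A \<subseteq> ?C" "closedin T B" "B \<subseteq> ?C" "?C = A \<union> B" for A B
  proof -
    have "S \<subseteq> A \<or> S \<subseteq> B"
    proof (rule ccontr)
      assume neg: "\<not> (S \<subseteq> A \<or> S \<subseteq> B)"
      have "(topspace T - A) \<inter> (topspace T - B) \<inter> S \<noteq> {}"
        using neg S(1) AB by (intro meet openin_diff) auto
      then show False using C(2) AB(5) by auto
    qed
    moreover have "?C \<subseteq> A" if "S \<subseteq> A" using that AB(1) by (rule closure_of_minimal)
    moreover have "?C \<subseteq> B" if "S \<subseteq> B" using that AB(3) by (rule closure_of_minimal)
    ultimately show ?thesis using AB(2,4) by blast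
  qed
  then show ?thesis
    unfolding irreducible_space_def C(1) closedin_closed_subtopology[OF C(3)]
    using S(2) C(2) by blast
qed

text \<open>Closures of irreducible sets are irreducible, and a closed set that contains \<open>S i\<close> but not
  \<open>S (Suc i)\<close> tells their closures apart.\<close>

lemma krull_dim_closure_ge:
  assumes S: "\<And>i. i \<le> n \<Longrightarrow> S i \<subseteq> D" "D \<subseteq> topspace T" "\<And>i. i \<le> n \<Longrightarrow> S i \<noteq> {}"
    and mono: "\<And>i. i < n \<Longrightarrow> S i \<subseteq> S (Suc i)"
    and meet: "\<And>i U1 U2. i \<le> n \<Longrightarrow> openin T U1 \<Longrightarrow> openin T U2 \<Longrightarrow>
        U1 \<inter> S i \<noteq> {} \<Longrightarrow> U2 \<inter> S i \<noteq> {} \<Longrightarrow> U1 \<inter> U2 \<inter> S i \<noteq> {}"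
    and strict: "\<And>i. i < n \<Longrightarrow> \<exists>C. closedin T C \<and> S i \<subseteq> C \<and> \<not> S (Suc i) \<subseteq> C"
  shows "enat n \<le> krull_dim (subtopology T (T closure_of D))"
proof -
  let ?Z = "\<lambda>i. T closure_of S i" and ?X = "T closure_of D"
  have sub: "?Z i \<subseteq> ?X" if "i \<le> n" for i
    using S(1)[OF that] by (rule closure_of_mono)
  have "closedin (subtopology T ?X) (?Z i) \<and> irreducible_space (subtopology (subtopology T ?X) (?Z i))"
    if "i \<le> n" for i
  proof
    show "closedin (subtopology T ?X) (?Z i)"
      using sub[OF that] by (simp add: closedin_closed_subtopology)
    have "?X \<inter> ?Z i = ?Z i" using sub[OF that] by blast
    moreover have "irreducible_space (subtopology T (?Z i))"
      using S that meet[OF that] by (intro irreducible_space_closure) blast+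
    ultimately show "irreducible_space (subtopology (subtopology T ?X) (?Z i))"
      by (simp add: subtopology_subtopology)
  qed
  moreover have "?Z i \<subset> ?Z (Suc i)" if i: "i < n" for i
  proof -
    obtain C where C: "closedin T C" "S i \<subseteq> C" "\<not> S (Suc i) \<subseteq> C" using strict[OF i] by blast
    have "?Z i \<subseteq> C" using C closure_of_minimal by blast
    moreover have "S (Suc i) \<subseteq> ?Z (Suc i)"
      using S(1)[of "Suc i"] S(2) i by (intro closure_of_subset) auto
    moreover have "?Z i \<subseteq> ?Z (Suc i)" using mono[OF i] by (rule closure_of_mono)
    ultimately show ?thesis using C(3) by blast
  qed
  ultimately show ?thesis unfolding krull_dim_def
    by (intro Sup_upper CollectI exI[of _ n] conjI refl exI[of _ ?Z]) auto
qed

section \<open>A form separating consecutive members of the chain\<close>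

lemma exponent_sum_add:
  "(\<Sum>v\<in>Poly_Mapping.keys (u + u'). Poly_Mapping.lookup (u + u') v) =
   (\<Sum>v\<in>Poly_Mapping.keys u. Poly_Mapping.lookup u v) + (\<Sum>v\<in>Poly_Mapping.keys u'. Poly_Mapping.lookup u' (v::'v) :: nat)"
proof -
  let ?V = "Poly_Mapping.keys u \<union> Poly_Mapping.keys u'"
  have *: "(\<Sum>v\<in>Poly_Mapping.keys x. Poly_Mapping.lookup x v) = (\<Sum>v\<in>?V. Poly_Mapping.lookup x v)"
    if "Poly_Mapping.keys x \<subseteq> ?V" for x :: "'v \<Rightarrow>\<^sub>0 nat"
    using that by (intro sum.mono_neutral_left) (auto simp: in_keys_iff)
  show ?thesis
    by (simp only: *[OF Poly_Mapping.keys_add] *[OF Un_upper1] *[OF Un_upper2])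
       (simp only: lookup_add sum.distrib)
qed

lemma exponent_sum_sum:
  "(\<Sum>v\<in>Poly_Mapping.keys (sum u J). Poly_Mapping.lookup (sum u J) v) =
   (\<Sum>j\<in>J. \<Sum>v\<in>Poly_Mapping.keys (u j). Poly_Mapping.lookup (u j) (v::'v) :: nat)"
  by (induction J rule: infinite_finite_induct) (auto simp: exponent_sum_add)

lemma exponent_sum_single:
  "(\<Sum>v\<in>Poly_Mapping.keys (Poly_Mapping.single w e). Poly_Mapping.lookup (Poly_Mapping.single w e) v) = (e::nat)"
  by simp

lemma degree_eval_mpoly_le:
  fixes y :: "'v \<Rightarrow> 'a::comm_ring_1 poly"
  assumes "homogeneous d g" "\<And>w. degree (y w) \<le> D"
  shows "degree (eval_mpoly (\<lambda>c. [:h c:]) y g) \<le> D * d"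
  unfolding eval_mpoly_def
proof (rule degree_sum_le)
  fix u assume u: "u \<in> Poly_Mapping.keys g"
  have "degree ([:h (Poly_Mapping.lookup g u):] * (\<Prod>v\<in>Poly_Mapping.keys u. y v ^ Poly_Mapping.lookup u v))
      \<le> degree (\<Prod>v\<in>Poly_Mapping.keys u. y v ^ Poly_Mapping.lookup u v)"
    by (rule order_trans[OF degree_mult_le]) simp
  also have "\<dots> \<le> (\<Sum>v\<in>Poly_Mapping.keys u. degree (y v ^ Poly_Mapping.lookup u v))"
    using degree_prod_sum_le[of "Poly_Mapping.keys u" "\<lambda>v. y v ^ Poly_Mapping.lookup u v"] by simp
  also have "\<dots> \<le> (\<Sum>v\<in>Poly_Mapping.keys u. D * Poly_Mapping.lookup u v)"
    by (intro sum_mono order_trans[OF degree_power_le] mult_right_mono assms(2)) simp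
  also have "\<dots> = D * d" using assms(1) u by (simp add: homogeneous_def flip: sum_distrib_left)
  finally show "degree ([:h (Poly_Mapping.lookup g u):] *
      (\<Prod>v\<in>Poly_Mapping.keys u. y v ^ Poly_Mapping.lookup u v)) \<le> D * d" .
qed simp

lemma degree_position_form_le:
  fixes y :: "nat \<Rightarrow> 'a::comm_ring_1 poly"
  assumes "\<And>i. degree (y i) \<le> 1"
  shows "degree (position_form A w y) \<le> 2"
  unfolding position_form_def
proof (intro degree_sum_le)
  fix i j
  show "degree (position A w i j * y i * y j) \<le> 2"
    using degree_mult_le[of "y i" "y j"] assms[of i] assms[of j] by (simp add: position_def)
qed simp_all

lemma (in comm_ring_hom) hom_position_form:
  "hom (position_form A w v) = position_form A w (\<lambda>i. hom (v i))"
proof -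
  have "hom (position A w i j) = position A w i j" for i j
    by (simp add: position_def)
  then show ?thesis by (simp add: position_form_def hom_sum hom_mult)
qed

context ladder_matrix
begin

text \<open>The separating form is a combination of monomials in the variables of the first row at places
  \<open>1, \<dots>, i + 2\<close>.  The monomials are numbered by the integers below \<open>base i ^ Suc i\<close>: the
  digits of the number are the exponents of the variables but the first, and the exponent of the
  first brings the degree up to \<open>total i\<close>.  The base is chosen large enough for
  \<open>grid_smaller_than_box\<close>.\<close>

definition base :: "nat \<Rightarrow> nat" where "base i = Suc ((2 * i + 3) ^ i)"

definition total :: "nat \<Rightarrow> nat" where "total i = Suc i * base i"

definition digit :: "nat \<Rightarrow> nat \<Rightarrow> nat \<Rightarrow> nat" where
  "digit i k j = k div base i ^ j mod base i"

definition digit_monom :: "nat \<Rightarrow> nat \<Rightarrow> (nat \<times> nat) \<Rightarrow>\<^sub>0 nat" where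
  "digit_monom i k = Poly_Mapping.single (1, 1) (total i - (\<Sum>j<Suc i. digit i k j)) +
     (\<Sum>j<Suc i. Poly_Mapping.single (1, Suc (Suc j)) (digit i k j))"

lemma sum_digit_le_total: "(\<Sum>j<Suc i. digit i k j) \<le> total i"
proof -
  have "(\<Sum>j<Suc i. digit i k j) \<le> (\<Sum>j<Suc i. base i)"
    unfolding digit_def by (intro sum_mono less_imp_le mod_less_divisor) (simp add: base_def)
  then show ?thesis by (simp add: total_def)
qed

lemma exponent_sum_digit_monom:
  "(\<Sum>v\<in>Poly_Mapping.keys (digit_monom i k). Poly_Mapping.lookup (digit_monom i k) v) = total i"
  unfolding digit_monom_def exponent_sum_add exponent_sum_sum exponent_sum_single
  using sum_digit_le_total[of i k] by linarith

lemma keys_digit_monom: "Poly_Mapping.keys (digit_monom i k) \<subseteq> {(1, Suc j) | j. j \<le> Suc i}"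
proof -
  have "Poly_Mapping.keys (\<Sum>j<Suc i. Poly_Mapping.single (1::nat, Suc (Suc j)) (digit i k j))
      \<subseteq> (\<Union>j<Suc i. Poly_Mapping.keys (Poly_Mapping.single (1, Suc (Suc j)) (digit i k j)))"
    by (rule Poly_Mapping.keys_sum)
  also have "\<dots> \<subseteq> {(1, Suc j) | j. j \<le> Suc i}" by (auto split: if_splits)
  finally show ?thesis unfolding digit_monom_def
    by (intro order_trans[OF Poly_Mapping.keys_add] Un_least) (auto split: if_splits)
qed

lemma eval_digit_monom:
  "eval_monom x (digit_monom i k) =
     x (1, 1) ^ (total i - (\<Sum>j<Suc i. digit i k j)) * (\<Prod>j<Suc i. x (1, Suc (Suc j)) ^ digit i k j)"
  unfolding digit_monom_def eval_monom_add eval_monom_sum by simp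

text \<open>With \<open>i\<close> free parameters the values on a grid grow like the \<open>i\<close>-th power of the degree,
  while the number of forms in \<open>i + 2\<close> variables grows like its power with exponent \<open>i + 1\<close>.\<close>

lemma grid_smaller_than_box: "(2 * total i + 1) ^ i < base i ^ Suc i"
proof -
  have "2 * total i + 1 \<le> (2 * i + 3) * base i"
    by (simp add: total_def base_def algebra_simps)
  then have "(2 * total i + 1) ^ i \<le> ((2 * i + 3) * base i) ^ i"
    by (rule power_mono) simp
  also have "\<dots> = (2 * i + 3) ^ i * base i ^ i" by (rule power_mult_distrib)
  also have "\<dots> < base i * base i ^ i"
    by (intro mult_strict_right_mono) (simp_all add: base_def)
  finally show ?thesis by simp
qed

text \<open>The first coordinate is normalized to 1, so that \<open>flag i\<close> is an affine space of
  dimension \<open>i\<close> and always contains \<open>e0\<close>.\<close>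

definition flag :: "nat \<Rightarrow> (nat \<Rightarrow> 'k alg_closure) set" where
  "flag i = {v. v 0 = 1 \<and> (\<forall>j>i. v j = 0)}"

definition digit_form :: "nat \<Rightarrow> (nat \<Rightarrow> 'k) \<Rightarrow> (nat \<times> nat, 'k) mpoly" where
  "digit_form i c = (\<Sum>k<base i ^ Suc i. Poly_Mapping.single (digit_monom i k) (c k))"

lemma eval_digit_form:
  fixes h :: "'k \<Rightarrow> 'a::comm_ring_1"
  assumes "comm_ring_hom h"
  shows "eval_mpoly h x (digit_form i c) = (\<Sum>k<base i ^ Suc i. h (c k) * eval_monom x (digit_monom i k))"
proof -
  interpret comm_ring_hom h by fact
  show ?thesis unfolding digit_form_def eval_mpoly_sum[OF assms]
    by (simp add: eval_mpoly_single)
qed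

lemma keys_digit_form: "Poly_Mapping.keys (digit_form i c) \<subseteq> range (digit_monom i)"
  unfolding digit_form_def
  by (rule order_trans[OF Poly_Mapping.keys_sum]) (auto split: if_splits)

lemma homogeneous_digit_form: "homogeneous (total i) (digit_form i c)"
  using keys_digit_form[of i c] by (auto simp: homogeneous_def exponent_sum_digit_monom)

text \<open>There are more monomials than points in a grid of side \<open>2 * total i + 1\<close> in \<open>flag i\<close>, hence a
  nontrivial combination vanishes on the grid.  Along position forms, which are quadratic, it has
  degree at most \<open>2 * total i\<close> in each coordinate, hence it vanishes on \<open>flag i\<close>.\<close>

lemma digit_form_vanishing_on_flag:
  obtains c where "\<exists>k<base i ^ Suc i. c k \<noteq> 0"
    "\<And>v. v \<in> flag i \<Longrightarrow> eval_mpoly to_ac (\<lambda>w. position_form A w v) (digit_form i c) = 0"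
proof -
  define N where "N = 2 * total i"
  define G where "G = (\<Pi>\<^sub>E j\<in>{1..i}. {..N})"
  define pt :: "(nat \<Rightarrow> nat) \<Rightarrow> nat \<Rightarrow> 'k" where
    "pt p j = (if j = 0 then 1 else if j \<le> i then of_nat (p j) else 0)" for p j
  have "card G = Suc N ^ i" "finite G"
    unfolding G_def by (simp_all add: card_PiE finite_PiE)
  then have "card G < card {..<base i ^ Suc i}"
    using grid_smaller_than_box[of i] by (simp add: N_def)
  then obtain c where c: "\<exists>k\<in>{..<base i ^ Suc i}. c k \<noteq> 0"
    "\<forall>p\<in>G. (\<Sum>k<base i ^ Suc i. c k * eval_monom (\<lambda>w. position_form A w (pt p)) (digit_monom i k)) = 0"
    using exists_linear_relation[of G "{..<base i ^ Suc i}"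
        "\<lambda>k p. eval_monom (\<lambda>w. position_form A w (pt p)) (digit_monom i k)"] \<open>finite G\<close>
    by blast
  interpret ac: comm_ring_hom "to_ac :: 'k \<Rightarrow> 'k alg_closure" by (rule comm_ring_hom_to_ac)
  let ?F = "\<lambda>v :: nat \<Rightarrow> 'k alg_closure. eval_mpoly to_ac (\<lambda>w. position_form A w v) (digit_form i c)"
  have grid: "?F (\<lambda>j. to_ac (pt p j)) = 0" if "p \<in> G" for p
  proof -
    have "?F (\<lambda>j. to_ac (pt p j)) = to_ac (\<Sum>k<base i ^ Suc i.
        c k * eval_monom (\<lambda>w. position_form A w (pt p)) (digit_monom i k))"
      unfolding eval_digit_form[OF comm_ring_hom_to_ac] eval_monom_def
      by (simp add: to_ac_sum to_ac_prod ac.hom_position_form)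
    then show ?thesis using c(2) that by simp
  qed
  have "?F v = 0" if v: "v \<in> flag i" for v
  proof (rule vanishing_on_grid[where F = ?F and N = N and J = "{1..i}" and v = v and ?v0.0 = e0])
    fix v :: "nat \<Rightarrow> 'k alg_closure" and j
    let ?y = "\<lambda>w. position_form A w (\<lambda>k. [:(v(j := 0)) k, if k = j then 1 else 0:])"
    have "degree (eval_mpoly (\<lambda>c. [:to_ac c:]) ?y (digit_form i c)) \<le> N"
      unfolding N_def by (intro degree_eval_mpoly_le homogeneous_digit_form degree_position_form_le) simp
    moreover have "?F (v(j := t)) = poly (eval_mpoly (\<lambda>c. [:to_ac c:]) ?y (digit_form i c)) t" for t
    proof -
      have "(\<lambda>k. poly [:(v(j := 0)) k, if k = j then 1 else 0:] t) = v(j := t)" by auto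
      then show ?thesis by (simp only: poly_eval_mpoly poly_position_form)
    qed
    ultimately show "\<exists>p. degree p \<le> N \<and> (\<forall>t. ?F (v(j := t)) = poly p t)" by blast
  next
    fix v :: "nat \<Rightarrow> 'k alg_closure"
    assume v: "\<And>j. j \<in> {1..i} \<Longrightarrow> v j \<in> of_nat ` {..N}" "\<And>j. j \<notin> {1..i} \<Longrightarrow> v j = e0 j"
    then have "\<forall>j\<in>{1..i}. \<exists>a. v j = of_nat a \<and> a \<le> N" by blast
    then obtain p where p: "\<And>j. j \<in> {1..i} \<Longrightarrow> v j = of_nat (p j) \<and> p j \<le> N" by metis
    have "restrict p {1..i} \<in> G" using p unfolding G_def by auto
    moreover have "v = (\<lambda>j. to_ac (pt (restrict p {1..i}) j))"
      using p v(2) by (force simp: pt_def e0_def)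
    ultimately show "?F v = 0" using grid by metis
  next
    fix j assume "j \<notin> {1..i}"
    then show "v j = e0 j" using v by (auto simp: flag_def e0_def)
  qed simp
  then show ?thesis using c(1) that[of c] by auto
qed

text \<open>Up to terms of order two in the later coordinates, the position forms of the first row are
  \<open>1\<close> and \<open>2 * v j\<close>, so the monomials in them are independent on \<open>flag (Suc i)\<close>.  This is
  seen on a curve where \<open>v (Suc j)\<close> is a power of \<open>s\<close> with exponent \<open>W + base i ^ j\<close>: the
  summand \<open>W\<close> makes the quadratic terms of higher order, and the powers of the base make the
  lowest order of the \<open>k\<close>-th monomial congruent to \<open>k\<close> modulo \<open>W\<close>.\<close>

lemma digit_form_nonzero_on_flag:
  assumes i: "i < n" and c: "\<exists>k<base i ^ Suc i. c k \<noteq> 0"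
  obtains v where "v \<in> flag (Suc i)"
    "eval_mpoly to_ac (\<lambda>w. position_form A w v) (digit_form i c) \<noteq> 0"
proof -
  define W where "W = base i ^ Suc i"
  (* \<omega> j is the exponent of s in the coordinate j of the curve. *)
  define \<omega> where "\<omega> j = (if j = 0 then 0 else W + base i ^ (j - 1))" for j
  define pt :: "'k alg_closure \<Rightarrow> nat \<Rightarrow> 'k alg_closure" where
    "pt s j = (if j \<le> Suc i then s ^ \<omega> j else 0)" for s j
  have b: "1 < base i" by (simp add: base_def)
  have \<omega>_less: "\<omega> j < \<omega> a + \<omega> b" if "j \<le> Suc i" "1 \<le> a" "1 \<le> b" for a b j
  proof -
    have "base i ^ (j - 1) < W" if "j \<noteq> 0"
      unfolding W_def using b \<open>j \<le> Suc i\<close> that by (intro power_strict_increasing) auto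
    moreover have "0 < W" using b by (simp add: W_def)
    ultimately show ?thesis using that by (auto simp: \<omega>_def)
  qed
  have "\<exists>r. poly r 0 \<noteq> 0 \<and> (\<forall>s. position_form A (1, Suc j) (pt s) = s ^ \<omega> j * poly r s)"
    if j: "j \<le> Suc i" for j
  proof -
    define r :: "'k alg_closure poly" where
      "r = [:if j = 0 then 1 else 2:] + (\<Sum>a=1..n. \<Sum>b=1..n.
        if a \<le> Suc i \<and> b \<le> Suc i then smult (position A (1, Suc j) a b) (monom 1 (\<omega> a + \<omega> b - \<omega> j)) else 0)"
    have "poly (if a \<le> Suc i \<and> b \<le> Suc i then smult (position A (1, Suc j) a b) (monom 1 (\<omega> a + \<omega> b - \<omega> j)) else 0) 0
        = (0 :: 'k alg_closure)" if "a \<in> {1..n}" "b \<in> {1..n}" for a b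
      using \<omega>_less[OF j, of a b] that by (auto simp: poly_monom)
    then have "poly r 0 \<noteq> 0" by (simp add: r_def poly_sum)
    moreover have "position_form A (1, Suc j) (pt s) = s ^ \<omega> j * poly r s" for s
    proof -
      have "position A (1, Suc j) a b * pt s a * pt s b = s ^ \<omega> j *
          poly (if a \<le> Suc i \<and> b \<le> Suc i then smult (position A (1, Suc j) a b) (monom 1 (\<omega> a + \<omega> b - \<omega> j)) else 0) s"
        if "a \<in> {1..n}" "b \<in> {1..n}" for a b
      proof -
        have "s ^ \<omega> a * s ^ \<omega> b = s ^ \<omega> j * s ^ (\<omega> a + \<omega> b - \<omega> j)"
          using \<omega>_less[OF j, of a b] that by (simp flip: power_add)
        then show ?thesis by (simp add: pt_def poly_monom mult_ac)
      qed
      then have "(\<Sum>a=1..n. \<Sum>b=1..n. position A (1, Suc j) a b * pt s a * pt s b) =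
          s ^ \<omega> j * poly (r - [:if j = 0 then 1 else 2:]) s"
        by (simp add: r_def poly_sum sum_distrib_left)
      moreover have "pt s 0 = 1" "pt s j = s ^ \<omega> j" using j by (simp_all add: pt_def \<omega>_def)
      moreover have "\<omega> j = 0" if "j = 0" using that by (simp add: \<omega>_def)
      ultimately show ?thesis using i j
        by (subst position_form_first_row) (auto simp: algebra_simps)
    qed
    ultimately show ?thesis by blast
  qed
  then obtain r where r: "\<And>j. j \<le> Suc i \<Longrightarrow> poly (r j) 0 \<noteq> 0"
    "\<And>j s. j \<le> Suc i \<Longrightarrow> position_form A (1, Suc j) (pt s) = s ^ \<omega> j * poly (r j) s"
    by metis
  define wt where "wt k = W * (\<Sum>j<Suc i. digit i k j) + k" for k
  define p where "p k = r 0 ^ (total i - (\<Sum>j<Suc i. digit i k j)) * (\<Prod>j<Suc i. r (Suc j) ^ digit i k j)" for k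
  have monom: "eval_monom (\<lambda>w. position_form A w (pt s)) (digit_monom i k) = s ^ wt k * poly (p k) s"
    if k: "k < W" for k s
  proof -
    have "(\<Prod>j<Suc i. position_form A (1, Suc (Suc j)) (pt s) ^ digit i k j) =
        (\<Prod>j<Suc i. s ^ (\<omega> (Suc j) * digit i k j) * poly (r (Suc j)) s ^ digit i k j)"
      by (intro prod.cong) (auto simp: r(2)[unfolded One_nat_def] power_mult_distrib power_mult)
    also have "\<dots> = s ^ (\<Sum>j<Suc i. \<omega> (Suc j) * digit i k j) * (\<Prod>j<Suc i. poly (r (Suc j)) s ^ digit i k j)"
      by (simp only: prod.distrib power_sum)
    also have "(\<Sum>j<Suc i. \<omega> (Suc j) * digit i k j) = wt k"
    proof -
      have "(\<Sum>j<Suc i. \<omega> (Suc j) * digit i k j) =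
          W * (\<Sum>j<Suc i. digit i k j) + (\<Sum>j<Suc i. digit i k j * base i ^ j)"
        by (simp add: \<omega>_def algebra_simps sum.distrib sum_distrib_left del: sum.lessThan_Suc)
      then show ?thesis using k sum_digits[of k "base i" "Suc i"]
        by (simp add: wt_def W_def digit_def del: sum.lessThan_Suc power_Suc)
    qed
    finally show ?thesis
      using r(2)[of 0 s] by (simp add: eval_digit_monom p_def poly_prod \<omega>_def del: sum.lessThan_Suc prod.lessThan_Suc)
  qed
  have "inj_on wt {..<W}"
  proof (rule inj_onI)
    fix k l assume "k \<in> {..<W}" "l \<in> {..<W}" "wt k = wt l"
    then have "k mod W = l mod W" unfolding wt_def by (metis mod_mult_self4)
    then show "k = l" using \<open>k \<in> {..<W}\<close> \<open>l \<in> {..<W}\<close> by simp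
  qed
  moreover have "poly (p k) 0 \<noteq> 0" for k
    using r(1) by (auto simp: p_def poly_prod simp del: prod.lessThan_Suc)
  ultimately obtain s where "(\<Sum>k<W. to_ac (c k) * (s ^ wt k * poly (p k) s)) \<noteq> 0"
    using lowest_term_survives[of "{..<W}" wt "\<lambda>k. to_ac (c k)" p] c by (auto simp: W_def)
  then have "eval_mpoly to_ac (\<lambda>w. position_form A w (pt s)) (digit_form i c) \<noteq> 0"
    unfolding eval_digit_form[OF comm_ring_hom_to_ac] W_def[symmetric] by (simp add: monom)
  moreover have "pt s \<in> flag (Suc i)" by (simp add: flag_def pt_def \<omega>_def)
  ultimately show ?thesis using that by blast
qed

end

section \<open>The image of the Gauss map\<close>

context ladder_matrix
begin

lemma first_row_entry_vars:
  assumes "j \<le> n"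
  shows "(1, Suc j) \<in> entry_vars A"
proof -
  have "A $$ (0, j) = Var (1, Suc j)" using ladder[of 0 j] assms by simp
  then show ?thesis unfolding entry_vars_def dim using assms
    by (intro CollectI exI[of _ "0::nat"], intro conjI exI[of _ j]) auto
qed

lemma antidiagonal_entry_vars: "antidiagonal \<subseteq> entry_vars A"
proof
  fix w assume "w \<in> antidiagonal"
  then obtain i j where w: "w = (i, j)" "2 \<le> i" "i \<le> j" "i + j = n + 3"
    by (auto simp: antidiagonal_def)
  then have "A $$ (i - 1, j - 1) = Var w"
    using ladder[of "i - 1" "j - 1"] by (simp add: min_def max_def)
  then show "w \<in> entry_vars A"
    using w unfolding entry_vars_def by (intro CollectI exI[of _ "i - 1"] conjI exI[of _ "j - 1"]) auto
qed

lemma position_form_coord_space: "(\<lambda>w. position_form A w v) \<in> coord_space (entry_vars A)"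
  by (auto simp: coord_space_def position_form_def position_def entry_vars_def intro!: sum.neutral)

lemma kernel_point_coord_space: "kernel_point v \<in> coord_space (entry_vars A)"
proof -
  have "kernel_point v w = 0" if w: "w \<notin> entry_vars A" for w
  proof -
    have "\<not> (fst w = 1 \<and> snd w \<in> {1..Suc n})"
    proof
      assume *: "fst w = 1 \<and> snd w \<in> {1..Suc n}"
      then have "w = (1, Suc (snd w - 1))" "snd w - 1 \<le> n" by (auto simp: prod_eq_iff)
      then show False using first_row_entry_vars[of "snd w - 1"] w by metis
    qed
    moreover have "w \<notin> antidiagonal" using antidiagonal_entry_vars w by blast
    ultimately show ?thesis by (simp only: kernel_point_def if_False)
  qed
  then show ?thesis by (simp add: coord_space_def)
qed

lemma kernel_scale:
  fixes h :: "'k \<Rightarrow> 'a::comm_ring_1"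
  assumes "comm_ring_hom h" "i < Suc n"
  shows "(\<Sum>j<Suc n. eval_mpoly h (\<lambda>w. c * a w) (A $$ (i, j)) * v j) =
      c * (\<Sum>j<Suc n. eval_mpoly h a (A $$ (i, j)) * v j)"
  unfolding eval_row[OF assms] by (simp add: sum_distrib_left mult.assoc)

lemma det_core_scale:
  fixes h :: "'k \<Rightarrow> 'a::comm_ring_1"
  assumes hom: "comm_ring_hom h"
  shows "det (core h (\<lambda>w. c * a w)) = c ^ n * det (core h a)"
proof -
  have "core h (\<lambda>w. c * a w) = c \<cdot>\<^sub>m core h a"
    by (rule eq_matI) (auto simp: core_def eval_entry[OF hom] sum_distrib_left mult.assoc)
  then show ?thesis by (simp add: core_def)
qed

lemma genericity_imp_nonzero:
  "genericity to_ac v \<noteq> 0 \<Longrightarrow> (\<lambda>w. position_form A w v) \<noteq> (\<lambda>_. 0)"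
  by (auto simp: genericity_def fun_eq_iff)

text \<open>The matrix \<open>kernel_point v\<close> is a point of the hypersurface at which the gradient is a nonzero
  multiple of the position forms at \<open>v\<close>.\<close>

lemma gauss_image:
  assumes n: "0 < n" and v0: "v 0 = 1" and gen: "genericity to_ac v \<noteq> 0"
  shows "proj_point (\<lambda>w. position_form A w v) \<in>
    {q \<in> proj_space (entry_vars A). \<exists>p\<in>smooth_points (entry_vars A) (det A).
      \<forall>b\<in>q. hyperplane (entry_vars A) b = tangent_hyperplane (entry_vars A) (det A) p}"
proof -
  define \<Phi> where "\<Phi> = (\<lambda>w. position_form A w v)"
  define a where "a = kernel_point v"
  let ?E = "entry_vars A" and ?f = "det A"
  have \<Phi>11: "\<Phi> (1, 1) \<noteq> 0" and det0: "det (core to_ac a) \<noteq> 0"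
    using gen by (auto simp: genericity_def \<Phi>_def a_def)
  have E11: "(1, 1) \<in> ?E" using first_row_entry_vars[of 0] by simp
  have det_ne: "det (core to_ac b) \<noteq> 0" if "b \<in> proj_point a" for b
    using that det0 by (auto simp: proj_point_def det_core_scale[OF comm_ring_hom_to_ac])
  have ker: "(\<Sum>j<Suc n. eval_mpoly to_ac b (A $$ (i, j)) * v j) = 0" if "b \<in> proj_point a" "i < Suc n" for b i
    using that kernel_point_kernel[OF comm_ring_hom_to_ac that(2), of v]
    by (auto simp: proj_point_def kernel_scale[OF comm_ring_hom_to_ac] a_def simp del: sum.lessThan_Suc)
  have on_f: "eval_mpoly to_ac b ?f = 0"
    and grad: "eval_mpoly to_ac b (partial_deriv w ?f) = det (core to_ac b) * \<Phi> w"
    if b: "b \<in> proj_point a" for b w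
    unfolding \<Phi>_def core_def
    using gradient_det[where a = b and v = v, OF comm_ring_hom_to_ac carrier variable_or_zero_A symmetric v0 ker[OF b]] by auto
  have "a \<noteq> (\<lambda>_. 0)"
  proof
    assume "a = (\<lambda>_. 0)"
    then have "det (core to_ac a) = 0"
      using det_core_scale[OF comm_ring_hom_to_ac, of 0 a] n by (simp only: mult_zero_left zero_power \<open>a = (\<lambda>_. 0)\<close>)
    with det0 show False ..
  qed
  then have "proj_point a \<in> proj_space ?E"
    using kernel_point_coord_space unfolding proj_space_def a_def by blast
  moreover have "\<not> vanishes_at (partial_deriv (1, 1) ?f) (proj_point a)"
  proof -
    have "eval_mpoly to_ac a (partial_deriv (1, 1) ?f) \<noteq> 0"
      unfolding grad[OF self_in_proj_point] using det0 \<Phi>11 by simp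
    then show ?thesis using self_in_proj_point unfolding vanishes_at_def by blast
  qed
  ultimately have smooth: "proj_point a \<in> smooth_points ?E ?f"
    using on_f E11 unfolding smooth_points_def hypersurface_def vanishes_at_def by blast
  have "hyperplane ?E q = tangent_hyperplane ?E ?f (proj_point a)" if q: "q \<in> proj_point \<Phi>" for q
  proof -
    obtain c where c: "c \<noteq> 0" "q = (\<lambda>w. c * \<Phi> w)" using q by (auto simp: proj_point_def)
    have "(\<Sum>w\<in>?E. q w * x w) = c * (\<Sum>w\<in>?E. \<Phi> w * x w)" for x
      by (simp add: c(2) sum_distrib_left mult.assoc)
    then have "(\<Sum>w\<in>?E. q w * x w) = 0 \<longleftrightarrow> (\<Sum>w\<in>?E. \<Phi> w * x w) = 0" for x
      using c(1) by simp
    moreover have "(\<Sum>w\<in>?E. eval_mpoly to_ac b (partial_deriv w ?f) * x w) =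
        det (core to_ac b) * (\<Sum>w\<in>?E. \<Phi> w * x w)" if "b \<in> proj_point a" for b x
      by (simp add: grad[OF that] sum_distrib_left mult.assoc)
    then have "(\<Sum>w\<in>?E. eval_mpoly to_ac b (partial_deriv w ?f) * x w) = 0 \<longleftrightarrow>
        (\<Sum>w\<in>?E. \<Phi> w * x w) = 0" if "b \<in> proj_point a" for b x
      using that det_ne[OF that] by simp
    ultimately have "(\<Sum>w\<in>?E. q w * x w) = 0 \<longleftrightarrow>
        (\<forall>b\<in>proj_point a. (\<Sum>w\<in>?E. eval_mpoly to_ac b (partial_deriv w ?f) * x w) = 0)" for x
      using self_in_proj_point[of a] by blast
    then show ?thesis unfolding hyperplane_def tangent_hyperplane_def by simp
  qed
  moreover have "proj_point \<Phi> \<in> proj_space ?E"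
    using genericity_imp_nonzero[OF gen] position_form_coord_space unfolding proj_space_def \<Phi>_def by blast
  ultimately show ?thesis using smooth unfolding \<Phi>_def by blast
qed

definition stratum :: "nat \<Rightarrow> (nat \<times> nat \<Rightarrow> 'k alg_closure) set set" where
  "stratum i = {proj_point (\<lambda>w. position_form A w v) | v. v \<in> flag i \<and> genericity to_ac v \<noteq> 0}"

lemma flag_line: "v \<in> flag i \<Longrightarrow> w \<in> flag i \<Longrightarrow> (\<lambda>j. v j + t * (w j - v j)) \<in> flag i"
  by (auto simp: flag_def)

text \<open>Two open sets meeting the stratum contain the images of principal open sets of the
  affine space \<open>flag i\<close>, and these have a point in common on a line.\<close>

lemma stratum_irreducible:
  assumes "openin (zariski (entry_vars A)) U1" "openin (zariski (entry_vars A)) U2"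
    and "U1 \<inter> stratum i \<noteq> {}" "U2 \<inter> stratum i \<noteq> {}"
  shows "U1 \<inter> U2 \<inter> stratum i \<noteq> {}"
proof -
  let ?\<Phi> = "\<lambda>v w. position_form A w (v :: nat \<Rightarrow> 'k alg_closure)"
  have pull: "\<exists>F v. polynomial_on_lines F \<and> v \<in> flag i \<and> F v \<noteq> 0 \<and>
      (\<forall>u\<in>flag i. F u \<noteq> 0 \<longrightarrow> proj_point (?\<Phi> u) \<in> U \<inter> stratum i)"
    if U: "openin (zariski (entry_vars A)) U" "U \<inter> stratum i \<noteq> {}" for U
  proof -
    obtain v where v: "v \<in> flag i" "genericity to_ac v \<noteq> 0" "proj_point (?\<Phi> v) \<in> U"
      using U(2) by (auto simp: stratum_def)
    obtain F where F: "polynomial_on_lines F" "F v \<noteq> 0"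
      "\<And>u. F u \<noteq> 0 \<Longrightarrow> ?\<Phi> u \<noteq> (\<lambda>_. 0) \<Longrightarrow> proj_point (?\<Phi> u) \<in> U"
      using zariski_open_pullback[of ?\<Phi>, OF polynomial_on_lines_position_form position_form_coord_space U(1) v(3)]
      by blast
    have "proj_point (?\<Phi> u) \<in> U \<inter> stratum i" if "u \<in> flag i" "F u * genericity to_ac u \<noteq> 0" for u
      using that F(3)[of u] genericity_imp_nonzero[of u] by (auto simp: stratum_def)
    then show ?thesis using F(1,2) v(1,2) polynomial_on_lines_genericity[OF comm_ring_hom_to_ac]
      by (intro exI[of _ "\<lambda>u. F u * genericity to_ac u"] exI[of _ v]) auto
  qed
  obtain F v where F: "polynomial_on_lines F" "v \<in> flag i" "F v \<noteq> 0"
    "\<forall>u\<in>flag i. F u \<noteq> 0 \<longrightarrow> proj_point (?\<Phi> u) \<in> U1 \<inter> stratum i"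
    using pull[OF assms(1,3)] by blast
  obtain G w where G: "polynomial_on_lines G" "w \<in> flag i" "G w \<noteq> 0"
    "\<forall>u\<in>flag i. G u \<noteq> 0 \<longrightarrow> proj_point (?\<Phi> u) \<in> U2 \<inter> stratum i"
    using pull[OF assms(2,4)] by blast
  obtain t where "F (\<lambda>j. v j + t * (w j - v j)) \<noteq> 0" "G (\<lambda>j. v j + t * (w j - v j)) \<noteq> 0"
    using polynomial_on_lines_nonzeros_meet[OF F(1) G(1) F(3) G(3)] by blast
  then show ?thesis using F(4) G(4) flag_line[OF F(2) G(2), of t] by blast
qed

text \<open>The form vanishes on the one stratum.  On the next it is nonzero somewhere on the flag, and
  then also at a generic point.\<close>

lemma stratum_separated:
  assumes i: "i < n"
  shows "\<exists>C. closedin (zariski (entry_vars A)) C \<and> stratum i \<subseteq> C \<and> \<not> stratum (Suc i) \<subseteq> C"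
proof -
  let ?E = "entry_vars A"
  let ?\<Phi> = "\<lambda>v w. position_form A w (v :: nat \<Rightarrow> 'k alg_closure)"
  obtain c where c: "\<exists>k<base i ^ Suc i. c k \<noteq> 0"
    "\<And>v. v \<in> flag i \<Longrightarrow> eval_mpoly to_ac (?\<Phi> v) (digit_form i c) = 0"
    using digit_form_vanishing_on_flag by blast
  let ?g = "digit_form i c"
  let ?C = "{p \<in> proj_space ?E. vanishes_at ?g p}"
  have "Poly_Mapping.keys (digit_monom i k) \<subseteq> ?E" for k
    using keys_digit_monom[of i k] first_row_entry_vars i by fastforce
  then have "?g \<in> polys_in ?E"
    using keys_digit_form[of i c] by (fastforce simp: polys_in_def)
  then have "closedin (zariski ?E) ?C"
    using homogeneous_digit_form by (rule closedin_zariski_vanishing)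
  moreover have van: "vanishes_at ?g (proj_point a) \<longleftrightarrow> eval_mpoly to_ac a ?g = 0" for a
    by (rule vanishes_at_proj_point[OF homogeneous_digit_form])
  have "proj_point (?\<Phi> v) \<in> proj_space ?E" if "genericity to_ac v \<noteq> 0" for v
    using genericity_imp_nonzero[OF that] position_form_coord_space unfolding proj_space_def by blast
  then have "stratum i \<subseteq> ?C" using c(2) by (auto simp: stratum_def van)
  moreover have "\<not> stratum (Suc i) \<subseteq> ?C"
  proof -
    obtain v where v: "v \<in> flag (Suc i)" "eval_mpoly to_ac (?\<Phi> v) ?g \<noteq> 0"
      using digit_form_nonzero_on_flag[OF i c(1)] by blast
    have e0: "e0 \<in> flag (Suc i)" by (simp add: flag_def e0_def)
    obtain t where t: "eval_mpoly to_ac (?\<Phi> (\<lambda>j. v j + t * (e0 j - v j))) ?g \<noteq> 0"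
      "genericity to_ac (\<lambda>j. v j + t * (e0 j - v j)) \<noteq> 0"
      using polynomial_on_lines_nonzeros_meet[OF
          polynomial_on_lines_eval_mpoly[of ?\<Phi> to_ac ?g, OF polynomial_on_lines_position_form]
          polynomial_on_lines_genericity[OF comm_ring_hom_to_ac] v(2) genericity_e0[OF comm_ring_hom_to_ac]]
      by blast
    then have "proj_point (?\<Phi> (\<lambda>j. v j + t * (e0 j - v j))) \<in> stratum (Suc i)"
      using flag_line[OF v(1) e0] by (auto simp: stratum_def)
    moreover have "proj_point (?\<Phi> (\<lambda>j. v j + t * (e0 j - v j))) \<notin> ?C"
      using t(1) by (simp add: van)
    ultimately show ?thesis by blast
  qed
  ultimately show ?thesis by blast
qed

lemma proj_dim_dual_variety_ge:
  assumes "0 < n"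
  shows "enat n \<le> proj_dim (entry_vars A) (dual_variety (entry_vars A) (det A))"
  unfolding proj_dim_def dual_variety_def
proof (rule krull_dim_closure_ge[where S = stratum])
  fix i
  show "stratum i \<subseteq> {q \<in> proj_space (entry_vars A). \<exists>p\<in>smooth_points (entry_vars A) (det A).
      \<forall>b\<in>q. hyperplane (entry_vars A) b = tangent_hyperplane (entry_vars A) (det A) p}"
    unfolding stratum_def using gauss_image[OF assms] by (fastforce simp: flag_def)
  have "e0 \<in> flag i" by (simp add: flag_def e0_def)
  then show "stratum i \<noteq> {}"
    using genericity_e0[OF comm_ring_hom_to_ac] by (auto simp: stratum_def)
  show "stratum i \<subseteq> stratum (Suc i)" by (force simp: stratum_def flag_def)
qed (use stratum_irreducible stratum_separated in \<open>auto simp: topspace_zariski\<close>)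

end

lemma degeneration_ladder_matrix:
  fixes \<sigma> :: "nat \<times> nat \<Rightarrow> (nat \<times> nat, 'k::field_char_0) mpoly"
  assumes co: "coordinate_like (Suc n) \<sigma>" and la: "ladderlike (Suc n + 2) (Suc n) \<sigma>"
  shows "ladder_matrix n (degeneration (Suc n) \<sigma>)"
proof -
  have entry: "degeneration (Suc n) \<sigma> $$ (i, j) = \<sigma> (min (Suc i) (Suc j), max (Suc i) (Suc j))"
    if "i < Suc n" "j < Suc n" for i j
    using that by (simp add: degeneration_def generic_sym_mat_def eval_mpoly_Var Const_def)
  have var: "(min (Suc i) (Suc j), max (Suc i) (Suc j)) \<in> sym_vars (Suc n)" if "i < Suc n" "j < Suc n" for i j
    using that by (auto simp: sym_vars_def)
  show ?thesis
  proof
    show "degeneration (Suc n) \<sigma> \<in> carrier_mat (Suc n) (Suc n)"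
      by (simp add: degeneration_def generic_sym_mat_def)
    fix i j assume ij: "i < Suc n" "j < Suc n"
    show "degeneration (Suc n) \<sigma> $$ (i, j) = 0 \<or> (\<exists>w\<in>sym_vars (Suc n). degeneration (Suc n) \<sigma> $$ (i, j) = Var w)"
      using co var[OF ij] by (simp add: entry[OF ij] coordinate_like_def)
    show "degeneration (Suc n) \<sigma> $$ (i, j) = degeneration (Suc n) \<sigma> $$ (j, i)"
      using ij by (simp add: entry min.commute max.commute)
    show "degeneration (Suc n) \<sigma> $$ (i, j) = Var (min (Suc i) (Suc j), max (Suc i) (Suc j))" if "i + j \<le> Suc n"
      using la var[OF ij] that unfolding ladderlike_def entry[OF ij]
      by (auto simp: min_def max_def split: if_splits)
  qed
qed

theorem theorem4p2:
  fixes m :: nat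
    and \<sigma> :: "nat \<times> nat \<Rightarrow> (nat \<times> nat, 'k::field_char_0) mpoly"
    and DS :: "(nat \<times> nat, 'k) mpoly mat"
  assumes "m \<ge> 3"
    and "coordinate_like m \<sigma>"
    and "ladderlike (m + 2) m \<sigma>"
    and "DS = degeneration m \<sigma>"
  shows "proj_dim (entry_vars DS) (dual_variety (entry_vars DS) (det DS)) \<ge> enat (m - 1)"
proof -
  obtain n where m: "m = Suc n" "0 < n" using assms(1) by (cases m) auto
  interpret ladder_matrix n DS
    using degeneration_ladder_matrix assms unfolding m by blast
  show ?thesis using proj_dim_dual_variety_ge m by simp
qed

end
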